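(* Let $d>1$ be an integer and let $n_1,\dots,n_p$ be positive integers with $\sum_{k=1}^p n_k=d+1$. Fix the location and the overlap type of the fixed points and the indices at them: that is, fix mutually distinct points $\zeta_1,\dots,\zeta_p\in\mathbb{C}$ and numbers $\iota_1,\dots,\iota_p\in\mathbb{C}$, and let $S\subset C\{n_1,\dots,n_p\}$ be the subset of all $R$ whose fixed points are exactly $\zeta_1,\dots,\zeta_p$, with $\zeta_k$ of multiplicity $n_k$ and with index $\iota_k$ at $\zeta_k$ for $k=1,\dots,p$. Assume that these data are realized by some rational function, i.e. $S\neq\emptyset$. Then $S$ has a natural complex manifold structure of dimension $d+1-p$, namely the one induced from the complex manifold structure of $C\{n_1,\dots,n_p\}$.
   Context: For an integer $d>1$, the canonical family $C_d$ is the set of all rational functions $R=P/Q$ of degree $d$ over $\mathbb{C}$ with $Q$ a monic polynomial of degree exactly $d$, $P$ a polynomial of degree at most $d$, and the resultant of $P$ and $Q$ nonzero (i.e. $P$ and $Q$ have no common zero). Every $R=P/Q\in C_d$ can be written $R(z)=z-\hat P(z)/Q(z)$ with $\hat P(z)=zQ(z)-P(z)=\prod_{j=1}^p (z-\zeta_j)^{n_j}$ monic of degree $d+1$, where the $\zeta_j\in\mathbb{C}$ are mutually distinct (they are the fixed points of $R$) and the positive integer $n_j$ is the multiplicity of $\zeta_j$; $\sum_j n_j=d+1$. The overlap type of $R$ is the collection (unordered, with repetition) $\{n_1,\dots,n_p\}$, and $C\{n_1,\dots,n_p\}$ is the set of $R\in C_d$ with overlap type $\{n_1,\dots,n_p\}$.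 The index of $R$ at a fixed point $\zeta\in\mathbb{C}$ is the residue at $\zeta$ of $\frac{1}{z-R(z)}$, i.e. $\frac{1}{2\pi i}\oint\frac{dz}{z-R(z)}$ over a small positively oriented circle around $\zeta$. Complex structure on $C\{n_1,\dots,n_p\}$: let $$\tilde E\{n_1,\dots,n_p\}=\Bigl\{(\zeta_1,\dots,\zeta_p,\alpha_{1,1},\dots,\alpha_{1,n_1},\alpha_{2,1},\dots,\alpha_{p,n_p})\in\mathbb{C}^{d+p+1}\Bigm| \zeta_k \text{ mutually distinct},\ \sum_{k=1}^p\alpha_{k,1}=1,\ \alpha_{k,n_k}\ne 0\ (k=1,\dots,p)\Bigr\},$$ and let $\Pi:\tilde E\{n_1,\dots,n_p\}\to C\{n_1,\dots,n_p\}$ send $(\zeta_k,\alpha_{k,\ell})$ to $R(z)=z-\hat P(z)/Q(z)$, where $\hat P(z)=\prod_{j=1}^p(z-\zeta_j)^{n_j}$ and $Q$ is the polynomial determined by $\frac{Q(z)}{\hat P(z)}=\sum_{k=1}^p\sum_{\ell=1}^{n_k}\frac{\alpha_{k,\ell}}{(z-\zeta_k)^\ell}$. The set $C\{n_1,\dots,n_p\}$ is given the complex manifold structure (of dimension $d+p$) for which $\Pi$ is a finite-sheeted holomorphic covering projection. *)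

theory Defs
  imports
    "HOL-Complex_Analysis.Complex_Analysis"
    "HOL-Computational_Algebra.Computational_Algebra"
    "HOL-Computational_Algebra.Field_as_Ring"
begin

section \<open>Holomorphic maps between open subsets of complex number spaces\<close>

text \<open>
  The space of dimension \<open>n\<close> is the set of sequences supported in \<open>{..<n}\<close>, as in
  \<^term>\<open>Euclidean_space\<close> for the reals. Dimension 0 is a point, and a space of smaller
  dimension is literally a coordinate subspace of a larger one.
\<close>

definition Cspace :: "nat \<Rightarrow> (nat \<Rightarrow> complex) set" where
  "Cspace n = {x. \<forall>i\<ge>n. x i = 0}"

definition Ctop :: "nat \<Rightarrow> (nat \<Rightarrow> complex) topology" where
  "Ctop n = top_of_set (Cspace n)"

text \<open>
  On open \<open>W\<close>, holomorphic means complex (Frechet) differentiable at every point; at a point \<open>z\<close>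
  the derivative of the \<open>j\<close>-th component is the linear form with coefficients \<open>a\<close>.
\<close>

definition holo :: "nat \<Rightarrow> nat \<Rightarrow> ((nat \<Rightarrow> complex) \<Rightarrow> nat \<Rightarrow> complex) \<Rightarrow> (nat \<Rightarrow> complex) set \<Rightarrow> bool" where
  "holo n m f W \<longleftrightarrow>
     openin (Ctop n) W \<and> f ` W \<subseteq> Cspace m \<and>
     (\<forall>z\<in>W. \<forall>j<m. \<exists>a :: nat \<Rightarrow> complex.
        ((\<lambda>w. cmod (f w j - f z j - (\<Sum>i<n. a i * (w i - z i))) / (\<Sum>i<n. cmod (w i - z i)))
           \<longlongrightarrow> 0) (at z within W))"


section \<open>Complex manifolds and submanifolds\<close>

text \<open>
  The second component of a chart is only relevant on the first one. A complex structure is a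
  maximal atlas.
\<close>

type_synonym 'a chart = "'a set \<times> ('a \<Rightarrow> nat \<Rightarrow> complex)"

record 'a cmanifold =
  mtop :: "'a topology"
  mdim :: nat
  charts :: "'a chart set"

definition is_chart :: "'a topology \<Rightarrow> nat \<Rightarrow> 'a chart \<Rightarrow> bool" where
  "is_chart X n = (\<lambda>(U, \<phi>).
     openin X U \<and> openin (Ctop n) (\<phi> ` U) \<and>
     homeomorphic_map (subtopology X U) (subtopology (Ctop n) (\<phi> ` U)) \<phi>)"

definition compatible :: "nat \<Rightarrow> 'a chart \<Rightarrow> 'a chart \<Rightarrow> bool" where
  "compatible n = (\<lambda>(U, \<phi>) (V, \<psi>).
     holo n n (\<psi> \<circ> inv_into U \<phi>) (\<phi> ` (U \<inter> V)) \<and>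
     holo n n (\<phi> \<circ> inv_into V \<psi>) (\<psi> ` (U \<inter> V)))"

text \<open>For an atlas \<open>B\<close> this is the unique maximal atlas containing \<open>B\<close>.\<close>

definition maximal_atlas :: "'a topology \<Rightarrow> nat \<Rightarrow> 'a chart set \<Rightarrow> 'a chart set" where
  "maximal_atlas X n B = {c. is_chart X n c \<and> (\<forall>b\<in>B. compatible n c b)}"

definition complex_manifold :: "'a cmanifold \<Rightarrow> bool" where
  "complex_manifold M \<longleftrightarrow>
     Hausdorff_space (mtop M) \<and> second_countable (mtop M) \<and>
     (\<forall>c\<in>charts M. is_chart (mtop M) (mdim M) c) \<and>
     (\<Union>(U, \<phi>)\<in>charts M. U) = topspace (mtop M) \<and>
     (\<forall>c\<in>charts M. \<forall>c'\<in>charts M. compatible (mdim M) c c') \<and>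
     maximal_atlas (mtop M) (mdim M) (charts M) \<subseteq> charts M"

definition Cmfd :: "nat \<Rightarrow> (nat \<Rightarrow> complex) cmanifold" where
  "Cmfd n = \<lparr>mtop = Ctop n, mdim = n, charts = maximal_atlas (Ctop n) n {(Cspace n, \<lambda>x. x)}\<rparr>"

text \<open>The charts of \<open>M\<close> in which \<open>S\<close> is the slice given by the vanishing of all but the first
  \<open>k\<close> coordinates.\<close>

definition slice_charts :: "'a cmanifold \<Rightarrow> 'a set \<Rightarrow> nat \<Rightarrow> 'a chart set" where
  "slice_charts M S k = {(U, \<phi>) \<in> charts M. \<phi> ` (U \<inter> S) = \<phi> ` U \<inter> Cspace k}"

definition complex_submanifold :: "'a cmanifold \<Rightarrow> 'a set \<Rightarrow> nat \<Rightarrow> bool" where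
  "complex_submanifold M S k \<longleftrightarrow>
     k \<le> mdim M \<and> S \<subseteq> topspace (mtop M) \<and> S \<subseteq> (\<Union>(U, \<phi>)\<in>slice_charts M S k. U)"

definition induced_manifold :: "'a cmanifold \<Rightarrow> 'a set \<Rightarrow> nat \<Rightarrow> 'a cmanifold" where
  "induced_manifold M S k =
     \<lparr>mtop = subtopology (mtop M) S, mdim = k,
      charts = maximal_atlas (subtopology (mtop M) S) k
                 ((\<lambda>(U, \<phi>). (U \<inter> S, \<phi>)) ` slice_charts M S k)\<rparr>"


section \<open>Holomorphic coverings\<close>

definition mfd_holomorphic_on :: "'a cmanifold \<Rightarrow> 'b cmanifold \<Rightarrow> ('a \<Rightarrow> 'b) \<Rightarrow> 'a set \<Rightarrow> bool" where
  "mfd_holomorphic_on M N f W \<longleftrightarrow>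
     openin (mtop M) W \<and> continuous_map (subtopology (mtop M) W) (mtop N) f \<and>
     (\<forall>(U, \<phi>)\<in>charts M. \<forall>(V, \<psi>)\<in>charts N.
        holo (mdim M) (mdim N) (\<psi> \<circ> f \<circ> inv_into U \<phi>) (\<phi> ` {x \<in> U \<inter> W. f x \<in> V}))"

definition biholomorphic_betw ::
    "'a cmanifold \<Rightarrow> 'b cmanifold \<Rightarrow> ('a \<Rightarrow> 'b) \<Rightarrow> 'a set \<Rightarrow> 'b set \<Rightarrow> bool" where
  "biholomorphic_betw M N f V U \<longleftrightarrow>
     bij_betw f V U \<and> mfd_holomorphic_on M N f V \<and> mfd_holomorphic_on N M (inv_into V f) U"

text \<open>Every point of \<open>N\<close> has a neighbourhood whose preimage is a disjoint union of \<open>s\<close> open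
  sheets, each mapped biholomorphically onto it.\<close>

definition finite_holomorphic_covering :: "'a cmanifold \<Rightarrow> 'b cmanifold \<Rightarrow> ('a \<Rightarrow> 'b) \<Rightarrow> bool" where
  "finite_holomorphic_covering M N f \<longleftrightarrow>
     mfd_holomorphic_on M N f (topspace (mtop M)) \<and>
     f ` topspace (mtop M) = topspace (mtop N) \<and>
     (\<exists>s. \<forall>y\<in>topspace (mtop N). \<exists>U \<V>.
        openin (mtop N) U \<and> y \<in> U \<and> finite \<V> \<and> card \<V> = s \<and> disjoint \<V> \<and>
        \<Union>\<V> = {x \<in> topspace (mtop M). f x \<in> U} \<and>
        (\<forall>V\<in>\<V>. openin (mtop M) V \<and> biholomorphic_betw M N f V U))"


section \<open>The canonical family and its fixed points\<close>

text \<open>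
  Rational functions are elements of the fraction field of \<^typ>\<open>complex poly\<close>. The library's
  \<^const>\<open>quot_of_fract\<close> yields the representation in lowest terms with monic denominator.
\<close>

definition numer :: "complex poly fract \<Rightarrow> complex poly" where
  "numer R = fst (quot_of_fract R)"

definition denom :: "complex poly fract \<Rightarrow> complex poly" where
  "denom R = snd (quot_of_fract R)"

definition ratfun_eval :: "complex poly fract \<Rightarrow> complex \<Rightarrow> complex" where
  "ratfun_eval R z = poly (numer R) z / poly (denom R) z"

definition canonical_family :: "nat \<Rightarrow> complex poly fract set" where
  "canonical_family d =
     {Fraction_Field.Fract P Q |P Q.
        lead_coeff Q = 1 \<and> degree Q = d \<and> degree P \<le> d \<and>
        \<not> (\<exists>z. poly P z = 0 \<and> poly Q z = 0)}"

definition fixpoint_poly :: "complex poly fract \<Rightarrow> complex poly" where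
  "fixpoint_poly R = [:0, 1:] * denom R - numer R"

definition fixpoints :: "complex poly fract \<Rightarrow> complex set" where
  "fixpoints R = {z. poly (fixpoint_poly R) z = 0}"

definition fixpoint_mult :: "complex poly fract \<Rightarrow> complex \<Rightarrow> nat" where
  "fixpoint_mult R \<zeta> = order \<zeta> (fixpoint_poly R)"

definition fixpoint_index :: "complex poly fract \<Rightarrow> complex \<Rightarrow> complex" where
  "fixpoint_index R \<zeta> = residue (\<lambda>z. 1 / (z - ratfun_eval R z)) \<zeta>"

definition overlap_type :: "complex poly fract \<Rightarrow> nat multiset" where
  "overlap_type R = image_mset (fixpoint_mult R) (mset_set (fixpoints R))"

text \<open>Families \<open>n\<^sub>1, \<dots>, n\<^sub>p\<close> and \<open>\<zeta>\<^sub>1, \<dots>, \<zeta>\<^sub>p\<close> are functions considered on \<open>{..<p}\<close>.\<close>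

definition overlap_family :: "nat \<Rightarrow> nat \<Rightarrow> (nat \<Rightarrow> nat) \<Rightarrow> complex poly fract set" where
  "overlap_family d p n =
     {R \<in> canonical_family d. overlap_type R = image_mset n (mset_set {..<p})}"

definition prescribed_family ::
    "nat \<Rightarrow> nat \<Rightarrow> (nat \<Rightarrow> nat) \<Rightarrow> (nat \<Rightarrow> complex) \<Rightarrow> (nat \<Rightarrow> complex) \<Rightarrow> complex poly fract set" where
  "prescribed_family d p n \<zeta> \<iota> =
     {R \<in> overlap_family d p n.
        fixpoints R = \<zeta> ` {..<p} \<and>
        (\<forall>k<p. fixpoint_mult R (\<zeta> k) = n k \<and> fixpoint_index R (\<zeta> k) = \<iota> k)}"


section \<open>The complex structure on the family of a given overlap type\<close>

text \<open>
  A parameter vector \<open>x\<close> lists \<open>\<zeta>\<^sub>k = x k\<close> for \<open>k < p\<close>, followed by the blocks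
  \<open>\<alpha>\<^sub>k\<^sub>,\<^sub>1, \<dots>, \<alpha>\<^sub>k\<^sub>,\<^sub>n\<^sub>k\<close>; the second index of \<open>\<alpha>\<close> starts at 1.
\<close>

definition coeff_alpha :: "nat \<Rightarrow> (nat \<Rightarrow> nat) \<Rightarrow> (nat \<Rightarrow> complex) \<Rightarrow> nat \<Rightarrow> nat \<Rightarrow> complex" where
  "coeff_alpha p n x k l = x (p + (\<Sum>j<k. n j) + (l - 1))"

definition param_space :: "nat \<Rightarrow> nat \<Rightarrow> (nat \<Rightarrow> nat) \<Rightarrow> (nat \<Rightarrow> complex) set" where
  "param_space d p n =
     {x \<in> Cspace (d + p + 1).
        inj_on x {..<p} \<and> (\<Sum>k<p. coeff_alpha p n x k 1) = 1 \<and>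
        (\<forall>k<p. coeff_alpha p n x k (n k) \<noteq> 0)}"

definition param_mfd :: "nat \<Rightarrow> nat \<Rightarrow> (nat \<Rightarrow> nat) \<Rightarrow> (nat \<Rightarrow> complex) cmanifold" where
  "param_mfd d p n = induced_manifold (Cmfd (d + p + 1)) (param_space d p n) (d + p)"

definition P_hat :: "nat \<Rightarrow> (nat \<Rightarrow> nat) \<Rightarrow> (nat \<Rightarrow> complex) \<Rightarrow> complex poly" where
  "P_hat p n x = (\<Prod>k<p. [:- x k, 1:] ^ n k)"

definition Q_poly :: "nat \<Rightarrow> (nat \<Rightarrow> nat) \<Rightarrow> (nat \<Rightarrow> complex) \<Rightarrow> complex poly" where
  "Q_poly p n x =
     (THE Q. Fraction_Field.Fract Q (P_hat p n x) =
        (\<Sum>k<p. \<Sum>l=1..n k. Fraction_Field.Fract [:coeff_alpha p n x k l:] ([:- x k, 1:] ^ l)))"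

definition param_proj :: "nat \<Rightarrow> (nat \<Rightarrow> nat) \<Rightarrow> (nat \<Rightarrow> complex) \<Rightarrow> complex poly fract" where
  "param_proj p n x =
     Fraction_Field.Fract [:0, 1:] 1 - Fraction_Field.Fract (P_hat p n x) (Q_poly p n x)"

text \<open>Such a structure is unique: its topology is the quotient topology, and its charts are
  determined by the local inverses of the projection.\<close>

definition overlap_structure ::
    "nat \<Rightarrow> nat \<Rightarrow> (nat \<Rightarrow> nat) \<Rightarrow> complex poly fract cmanifold \<Rightarrow> bool" where
  "overlap_structure d p n M \<longleftrightarrow>
     complex_manifold M \<and> mdim M = d + p \<and> topspace (mtop M) = overlap_family d p n \<and>
     finite_holomorphic_covering (param_mfd d p n) M (param_proj p n)"

end

theory Submission
  imports Defs
begin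

text \<open>
  By the partial fraction decomposition, a function of the given overlap type is described by its
  fixed points \<open>\<zeta>\<^sub>k\<close> and the coefficients \<open>\<alpha>\<^sub>k\<^sub>,\<^sub>l\<close>. The poles of \<open>1/(z - R(z)) = Q/P_hat\<close> show that \<open>\<zeta>\<^sub>k\<close> has
  multiplicity \<open>n\<^sub>k\<close> and index \<open>\<alpha>\<^sub>k\<^sub>,\<^sub>1\<close> (\<open>order_fixpoint_poly\<close>, \<open>fixpoint_index_param_proj\<close>). In
  the parameter space, prescribing fixed points and indices therefore means to prescribe the \<open>2p\<close>
  coordinates \<open>\<zeta>\<^sub>k\<close> and \<open>\<alpha>\<^sub>k\<^sub>,\<^sub>1\<close>, locally at least, since the function knows its fixed points only up to
  order (\<open>prescribed_family_near\<close>). The parameter space is an open part of the hyperplane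
  \<open>\<Sum>\<alpha>\<^sub>k\<^sub>,\<^sub>1 = 1\<close>. Hence only \<open>2p - 1\<close> of these conditions are independent on it, and the slice has
  dimension \<open>(d + p) - (2p - 1) = d + 1 - p\<close>.

  One affine change of coordinates turns the hyperplane and the slice into coordinate subspaces at the
  same time (\<open>straighten_in_charts_Cmfd\<close>, \<open>straighten_slice\<close>). On a sheet of the covering the
  projection is biholomorphic, so this chart can be carried over to the family of the given overlap type,
  where the maximality of the atlas makes it a chart (\<open>biholomorphic_chart_transport\<close>). Thus every
  point of the prescribed family has a slice chart. That slice charts induce a complex manifold
  structure is a general fact (\<open>complex_manifold_induced\<close>).
\<close>


section \<open>Holomorphic maps in coordinates\<close>

definition l1_dist :: "nat \<Rightarrow> (nat \<Rightarrow> complex) \<Rightarrow> (nat \<Rightarrow> complex) \<Rightarrow> real" where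
  "l1_dist n w z = (\<Sum>i<n. cmod (w i - z i))"

text \<open>
  Multiplying out the difference quotient makes the condition true at \<open>w = z\<close> as well, so that in
  a composition the inner map may return to its value at the base point.
\<close>

definition differential_at ::
    "nat \<Rightarrow> (nat \<Rightarrow> complex) set \<Rightarrow> ((nat \<Rightarrow> complex) \<Rightarrow> complex) \<Rightarrow> (nat \<Rightarrow> complex) \<Rightarrow> (nat \<Rightarrow> complex) \<Rightarrow> bool"
  where
  "differential_at n W g z a \<longleftrightarrow>
     (\<forall>e>0. \<exists>\<delta>>0. \<forall>w\<in>W. l1_dist n w z < \<delta> \<longrightarrow>
        cmod (g w - g z - (\<Sum>i<n. a i * (w i - z i))) \<le> e * l1_dist n w z)"

lemma l1_dist_nonneg: "0 \<le> l1_dist n w z"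
  by (simp add: l1_dist_def sum_nonneg)

lemma l1_dist_self [simp]: "l1_dist n z z = 0"
  by (simp add: l1_dist_def)

lemma cmod_le_l1_dist: "i < n \<Longrightarrow> cmod (w i - z i) \<le> l1_dist n w z"
  unfolding l1_dist_def by (rule member_le_sum) auto

lemma l1_dist_pos:
  assumes "w \<in> Cspace n" "z \<in> Cspace n" "w \<noteq> z"
  shows "0 < l1_dist n w z"
proof -
  obtain i where i: "w i \<noteq> z i" using assms(3) by auto
  then have "i < n" using assms(1,2) unfolding Cspace_def by (metis (mono_tags) mem_Collect_eq not_less)
  with i show ?thesis using cmod_le_l1_dist[of i n w z] by (smt (verit) zero_less_norm_iff right_minus_eq)
qed

lemma l1_dist_Cspace_mono:
  assumes "w \<in> Cspace k" "z \<in> Cspace k" "k \<le> n"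
  shows "l1_dist n w z = l1_dist k w z"
  unfolding l1_dist_def
  by (rule sum.mono_neutral_right) (use assms in \<open>auto simp: Cspace_def\<close>)

lemma Cspace_mono: "k \<le> n \<Longrightarrow> Cspace k \<subseteq> Cspace n"
  by (auto simp: Cspace_def)

lemma open_l1_ball: "open {w. l1_dist n w z < \<delta>}"
  unfolding l1_dist_def by (intro open_Collect_less continuous_intros continuous_on_product_coordinates)

lemma open_contains_l1_ball:
  assumes "open S" "z \<in> S" "z \<in> Cspace n"
  shows "\<exists>\<delta>>0. \<forall>w\<in>Cspace n. l1_dist n w z < \<delta> \<longrightarrow> w \<in> S"
proof -
  from assms(1,2) obtain X where X: "z \<in> (\<Pi>\<^sub>E i\<in>UNIV. X i)" "\<And>i. open (X i)"
      "finite {i. X i \<noteq> UNIV}" "(\<Pi>\<^sub>E i\<in>UNIV. X i) \<subseteq> S"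
    unfolding open_fun_def
    using product_topology_open_contains_basis[of "\<lambda>_. euclidean" UNIV S z] by (auto simp: PiE_def)
  have "\<exists>e>0. ball (z i) e \<subseteq> X i" for i
    using X(1,2) by (simp add: PiE_iff open_contains_ball)
  then obtain e where e: "\<And>i. e i > 0" "\<And>i. ball (z i) (e i) \<subseteq> X i" by metis
  define \<delta> where "\<delta> = Min (insert 1 (e ` {..<n}))"
  have \<delta>: "\<delta> > 0" "\<And>i. i < n \<Longrightarrow> \<delta> \<le> e i" using e(1) by (auto simp: \<delta>_def)
  have "w \<in> S" if w: "w \<in> Cspace n" "l1_dist n w z < \<delta>" for w
  proof -
    have "w i \<in> X i" for i
    proof (cases "i < n")
      case True
      then have "w i \<in> ball (z i) (e i)"
        using cmod_le_l1_dist[OF True, of w z] w(2) \<delta>(2)[OF True]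
        by (simp add: dist_norm norm_minus_commute)
      then show ?thesis using e(2) by blast
    next
      case False
      then have "w i = z i" using w(1) assms(3) by (simp add: Cspace_def)
      then show ?thesis using X(1) by (simp add: PiE_iff)
    qed
    then show ?thesis using X(4) by (auto simp: PiE_iff)
  qed
  with \<delta>(1) show ?thesis by blast
qed

lemma topspace_Ctop [simp]: "topspace (Ctop n) = Cspace n"
  by (simp add: Ctop_def)

text \<open>The ambient topology is the product topology on all sequences; on \<open>Cspace n\<close> it is the one of
  the metric \<open>l1_dist\<close>, which turns every statement about neighbourhoods into an estimate.\<close>

lemma openin_Ctop_iff:
  "openin (Ctop n) U \<longleftrightarrow>
     U \<subseteq> Cspace n \<and> (\<forall>z\<in>U. \<exists>\<delta>>0. \<forall>w\<in>Cspace n. l1_dist n w z < \<delta> \<longrightarrow> w \<in> U)"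
  (is "?L \<longleftrightarrow> ?R")
proof
  assume ?L
  then obtain S where S: "open S" "U = Cspace n \<inter> S" by (auto simp: Ctop_def openin_open)
  then show ?R using open_contains_l1_ball[OF S(1)] by auto
next
  assume R: ?R
  then obtain \<delta> where \<delta>: "\<And>z. z \<in> U \<Longrightarrow> \<delta> z > 0"
      "\<And>z w. z \<in> U \<Longrightarrow> w \<in> Cspace n \<Longrightarrow> l1_dist n w z < \<delta> z \<Longrightarrow> w \<in> U" by metis
  have "U = Cspace n \<inter> (\<Union>z\<in>U. {w. l1_dist n w z < \<delta> z})" using R \<delta> by auto
  moreover have "open (\<Union>z\<in>U. {w. l1_dist n w z < \<delta> z})" using open_l1_ball by blast
  ultimately show ?L unfolding Ctop_def openin_open by blast
qed

lemma openin_Ctop_Int: "open G \<Longrightarrow> openin (Ctop n) (Cspace n \<inter> G)"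
  by (simp add: Ctop_def openin_open_Int)

lemma open_Collect_coordinates_neq:
  "open {x :: nat \<Rightarrow> complex. x i \<noteq> x j}" "open {x :: nat \<Rightarrow> complex. x i \<noteq> c}"
  by (intro open_Collect_neq continuous_intros continuous_on_product_coordinates)+

lemma open_Collect_separated:
  fixes c :: "nat \<Rightarrow> complex"
  shows "open {x :: nat \<Rightarrow> complex. \<forall>i<p. \<forall>j<p. i \<noteq> j \<longrightarrow> x i \<noteq> c j}"
proof -
  have "{x :: nat \<Rightarrow> complex. \<forall>i<p. \<forall>j<p. i \<noteq> j \<longrightarrow> x i \<noteq> c j} = (\<Inter>i<p. \<Inter>j\<in>{..<p} - {i}. {x. x i \<noteq> c j})"
    by auto
  then show ?thesis by (simp add: open_INT open_Collect_coordinates_neq)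
qed

lemma open_Collect_inj_on: "open {x :: nat \<Rightarrow> complex. inj_on x {..<p}}"
proof -
  have "{x :: nat \<Rightarrow> complex. inj_on x {..<p}} = (\<Inter>i<p. \<Inter>j\<in>{..<p} - {i}. {x. x i \<noteq> x j})"
    by (auto simp: inj_on_def)
  then show ?thesis by (simp add: open_INT open_Collect_coordinates_neq)
qed

lemma eventually_at_Cspace:
  assumes "W \<subseteq> Cspace n" "z \<in> Cspace n"
  shows "eventually P (at z within W) \<longleftrightarrow>
           (\<exists>\<delta>>0. \<forall>w\<in>W. w \<noteq> z \<and> l1_dist n w z < \<delta> \<longrightarrow> P w)" (is "?L \<longleftrightarrow> ?R")
proof
  assume ?L
  then obtain S where S: "open S" "z \<in> S" "\<And>w. w \<in> S \<Longrightarrow> w \<noteq> z \<Longrightarrow> w \<in> W \<Longrightarrow> P w"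
    by (auto simp: eventually_at_topological)
  from open_contains_l1_ball[OF S(1,2) assms(2)] show ?R using S(3) assms(1) by blast
next
  assume ?R
  then obtain \<delta> where "\<delta> > 0" "\<forall>w\<in>W. w \<noteq> z \<and> l1_dist n w z < \<delta> \<longrightarrow> P w" by blast
  then show ?L using open_l1_ball[of n z \<delta>]
    by (auto simp: eventually_at_topological intro!: exI[of _ "{w. l1_dist n w z < \<delta>}"])
qed

lemma holo_iff:
  "holo n m f W \<longleftrightarrow>
     openin (Ctop n) W \<and> f ` W \<subseteq> Cspace m \<and>
     (\<forall>z\<in>W. \<forall>j<m. \<exists>a. differential_at n W (\<lambda>w. f w j) z a)"
proof -
  have eq: "((\<lambda>w. cmod (f w j - f z j - (\<Sum>i<n. a i * (w i - z i))) / (\<Sum>i<n. cmod (w i - z i)))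
                \<longlongrightarrow> 0) (at z within W) \<longleftrightarrow> differential_at n W (\<lambda>w. f w j) z a" (is "?L \<longleftrightarrow> ?R")
    if W: "W \<subseteq> Cspace n" and z: "z \<in> W" for z j a
  proof -
    let ?q = "\<lambda>w. cmod (f w j - f z j - (\<Sum>i<n. a i * (w i - z i)))"
    have zC: "z \<in> Cspace n" using W z by auto
    have pos: "l1_dist n w z > 0" if "w \<in> W" "w \<noteq> z" for w
      using l1_dist_pos that W zC by blast
    have "?L \<longleftrightarrow> (\<forall>e>0. \<exists>\<delta>>0. \<forall>w\<in>W. w \<noteq> z \<and> l1_dist n w z < \<delta> \<longrightarrow> ?q w / l1_dist n w z < e)"
      unfolding tendsto_iff eventually_at_Cspace[OF W zC] l1_dist_def[symmetric]
      using l1_dist_nonneg[of n _ z] by (simp add: dist_norm)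
    also have "\<dots> \<longleftrightarrow> (\<forall>e>0. \<exists>\<delta>>0. \<forall>w\<in>W. w \<noteq> z \<and> l1_dist n w z < \<delta> \<longrightarrow> ?q w < e * l1_dist n w z)"
      using pos by (simp add: pos_divide_less_eq cong: conj_cong imp_cong ball_cong)
    also have "\<dots> \<longleftrightarrow> ?R"
    proof
      assume H: "\<forall>e>0. \<exists>\<delta>>0. \<forall>w\<in>W. w \<noteq> z \<and> l1_dist n w z < \<delta> \<longrightarrow> ?q w < e * l1_dist n w z"
      show ?R unfolding differential_at_def
      proof (intro allI impI)
        fix e :: real assume "e > 0"
        with H obtain \<delta> where "\<delta> > 0" "\<forall>w\<in>W. w \<noteq> z \<and> l1_dist n w z < \<delta> \<longrightarrow> ?q w < e * l1_dist n w z"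
          by blast
        then show "\<exists>\<delta>>0. \<forall>w\<in>W. l1_dist n w z < \<delta> \<longrightarrow> ?q w \<le> e * l1_dist n w z"
          by (intro exI[of _ \<delta>]) (metis (no_types, lifting) l1_dist_self diff_self less_eq_real_def
              mult_zero_right norm_zero sum.neutral mult_zero_right)
      qed
    next
      assume R: ?R
      show "\<forall>e>0. \<exists>\<delta>>0. \<forall>w\<in>W. w \<noteq> z \<and> l1_dist n w z < \<delta> \<longrightarrow> ?q w < e * l1_dist n w z"
      proof (intro allI impI)
        fix e :: real assume e: "e > 0"
        then have "e / 2 > 0" by simp
        with R obtain \<delta> where \<delta>: "\<delta> > 0" "\<And>w. w \<in> W \<Longrightarrow> l1_dist n w z < \<delta> \<Longrightarrow> ?q w \<le> e / 2 * l1_dist n w z"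
          unfolding differential_at_def by meson
        have "?q w < e * l1_dist n w z" if "w \<in> W" "w \<noteq> z" "l1_dist n w z < \<delta>" for w
          using \<delta>(2)[OF that(1,3)] mult_pos_pos[OF e pos[OF that(1,2)]] by linarith
        with \<delta>(1) show "\<exists>\<delta>>0. \<forall>w\<in>W. w \<noteq> z \<and> l1_dist n w z < \<delta> \<longrightarrow> ?q w < e * l1_dist n w z"
          by blast
      qed
    qed
    finally show ?thesis .
  qed
  show ?thesis
    unfolding holo_def using openin_subset[of "Ctop n" W] by (auto simp: eq)
qed

lemma holo_differentiable:
  "holo n m f W \<Longrightarrow> z \<in> W \<Longrightarrow> j < m \<Longrightarrow> \<exists>a. differential_at n W (\<lambda>w. f w j) z a"
  by (simp add: holo_iff)

lemma holo_open: "holo n m f W \<Longrightarrow> openin (Ctop n) W"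
  by (simp add: holo_def)

lemma holo_image: "holo n m f W \<Longrightarrow> f ` W \<subseteq> Cspace m"
  by (simp add: holo_def)

lemma differential_at_subset:
  "differential_at n W g z a \<Longrightarrow> V \<subseteq> W \<Longrightarrow> differential_at n V g z a"
  unfolding differential_at_def by (meson subsetD)

lemma holo_subset: "holo n m f W \<Longrightarrow> openin (Ctop n) V \<Longrightarrow> V \<subseteq> W \<Longrightarrow> holo n m f V"
  unfolding holo_iff by (meson differential_at_subset image_mono subset_trans subsetD)

lemma holo_cong:
  assumes "holo n m f W" "\<And>w. w \<in> W \<Longrightarrow> g w = f w"
  shows "holo n m g W"
proof -
  have "differential_at n W (\<lambda>w. g w j) z = differential_at n W (\<lambda>w. f w j) z" if "z \<in> W" for z j
    unfolding differential_at_def fun_eq_iff using assms(2) that by simp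
  moreover have "g ` W = f ` W" using assms(2) by (rule image_cong[OF refl])
  ultimately show ?thesis using assms(1) unfolding holo_iff by simp
qed

text \<open>
  A derivative is tested on small \<open>l1_dist\<close>-balls only, and an open \<open>V\<close> contains such a ball around
  each of its points.
\<close>

lemma holo_local:
  assumes "openin (Ctop n) W" "\<And>z. z \<in> W \<Longrightarrow> \<exists>V. z \<in> V \<and> V \<subseteq> W \<and> holo n m f V"
  shows "holo n m f W"
  unfolding holo_iff
proof (intro conjI ballI allI impI)
  show "f ` W \<subseteq> Cspace m" using assms(2) holo_image by blast
next
  fix z j assume "z \<in> W" "j < m"
  then obtain V where V: "z \<in> V" "V \<subseteq> W" "holo n m f V" using assms(2) by blast
  then obtain a where a: "differential_at n V (\<lambda>w. f w j) z a"
    using \<open>j < m\<close> holo_differentiable by blast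
  obtain d where d: "d > 0" "\<And>w. w \<in> Cspace n \<Longrightarrow> l1_dist n w z < d \<Longrightarrow> w \<in> V"
    using holo_open[OF V(3)] V(1) by (auto simp: openin_Ctop_iff)
  have "differential_at n W (\<lambda>w. f w j) z a"
    unfolding differential_at_def
  proof (intro allI impI)
    fix e :: real assume "e > 0"
    with a obtain \<delta> where "\<delta> > 0" and \<delta>: "\<forall>w\<in>V. l1_dist n w z < \<delta> \<longrightarrow>
        cmod (f w j - f z j - (\<Sum>i<n. a i * (w i - z i))) \<le> e * l1_dist n w z"
      unfolding differential_at_def by blast
    then show "\<exists>\<delta>>0. \<forall>w\<in>W. l1_dist n w z < \<delta> \<longrightarrow>
        cmod (f w j - f z j - (\<Sum>i<n. a i * (w i - z i))) \<le> e * l1_dist n w z"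
      using d openin_subset[OF assms(1)] by (intro exI[of _ "min d \<delta>"]) auto
  qed
  then show "\<exists>a. differential_at n W (\<lambda>w. f w j) z a" by (rule exI[of _ a])
qed (fact assms(1))

lemma holo_affine:
  assumes "openin (Ctop n) W" "f ` W \<subseteq> Cspace m"
    and "\<And>w j. w \<in> W \<Longrightarrow> j < m \<Longrightarrow> f w j = b j + (\<Sum>i<n. a j i * w i)"
  shows "holo n m f W"
proof -
  have "differential_at n W (\<lambda>w. f w j) z (a j)" if "z \<in> W" "j < m" for z j
    unfolding differential_at_def
    using assms(3) that l1_dist_nonneg
    by (auto intro!: exI[of _ 1] simp: right_diff_distrib sum_subtractf)
  then show ?thesis unfolding holo_iff using assms(1,2) by blast
qed

text \<open>
  The matrix norm controls the linear part, which yields a local Lipschitz bound. Both continuity and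
  the chain rule rest on it.
\<close>

lemma l1_dist_image_le:
  assumes "\<And>j. j < m \<Longrightarrow> cmod (f w j - f z j - (\<Sum>i<n. a j i * (w i - z i))) \<le> e * l1_dist n w z"
  shows "l1_dist m (f w) (f z) \<le> (m * e + (\<Sum>j<m. \<Sum>i<n. cmod (a j i))) * l1_dist n w z"
proof -
  have "cmod (f w j - f z j) \<le> (e + (\<Sum>i<n. cmod (a j i))) * l1_dist n w z" if "j < m" for j
  proof -
    have "cmod (f w j - f z j) \<le> cmod (f w j - f z j - (\<Sum>i<n. a j i * (w i - z i))) + cmod (\<Sum>i<n. a j i * (w i - z i))"
      by (metis diff_add_cancel norm_triangle_ineq)
    also have "cmod (\<Sum>i<n. a j i * (w i - z i)) \<le> (\<Sum>i<n. cmod (a j i) * l1_dist n w z)"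
      by (rule sum_norm_le) (auto simp: norm_mult intro!: mult_left_mono cmod_le_l1_dist)
    finally show ?thesis using assms[OF that] by (simp add: distrib_right sum_distrib_right)
  qed
  then have "l1_dist m (f w) (f z) \<le> (\<Sum>j<m. (e + (\<Sum>i<n. cmod (a j i))) * l1_dist n w z)"
    unfolding l1_dist_def[of m] by (intro sum_mono) auto
  also have "\<dots> = (m * e + (\<Sum>j<m. \<Sum>i<n. cmod (a j i))) * l1_dist n w z"
    by (simp add: sum_distrib_right[symmetric] sum.distrib)
  finally show ?thesis .
qed

text \<open>
  Only finitely many components matter, so one radius serves all of them.
\<close>

lemma holo_differentials:
  assumes "holo n m f W" "z \<in> W"
  obtains a where "\<And>e. e > 0 \<Longrightarrow> \<exists>\<delta>>0. \<forall>w\<in>W. l1_dist n w z < \<delta> \<longrightarrow>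
     (\<forall>j<m. cmod (f w j - f z j - (\<Sum>i<n. a j i * (w i - z i))) \<le> e * l1_dist n w z)"
proof -
  from assms have "\<forall>j. \<exists>a. j < m \<longrightarrow> differential_at n W (\<lambda>w. f w j) z a" by (auto simp: holo_iff)
  then obtain a where a: "\<And>j. j < m \<Longrightarrow> differential_at n W (\<lambda>w. f w j) z (a j)" by metis
  show thesis
  proof (rule that)
    fix e :: real assume "e > 0"
    then have "\<forall>j. \<exists>\<delta>. j < m \<longrightarrow> \<delta> > 0 \<and> (\<forall>w\<in>W. l1_dist n w z < \<delta> \<longrightarrow>
       cmod (f w j - f z j - (\<Sum>i<n. a j i * (w i - z i))) \<le> e * l1_dist n w z)"
      using a unfolding differential_at_def by blast
    then obtain \<delta> where \<delta>: "\<And>j. j < m \<Longrightarrow> \<delta> j > 0 \<and> (\<forall>w\<in>W. l1_dist n w z < \<delta> j \<longrightarrow>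
       cmod (f w j - f z j - (\<Sum>i<n. a j i * (w i - z i))) \<le> e * l1_dist n w z)"
      by metis
    show "\<exists>\<delta>>0. \<forall>w\<in>W. l1_dist n w z < \<delta> \<longrightarrow>
     (\<forall>j<m. cmod (f w j - f z j - (\<Sum>i<n. a j i * (w i - z i))) \<le> e * l1_dist n w z)"
      using \<delta> by (intro exI[of _ "Min (insert 1 (\<delta> ` {..<m}))"]) auto
  qed
qed

lemma holo_continuous:
  assumes "holo n m f W" "z \<in> W" "e > 0"
  shows "\<exists>\<delta>>0. \<forall>w\<in>W. l1_dist n w z < \<delta> \<longrightarrow> l1_dist m (f w) (f z) < e"
proof -
  obtain a where a: "\<And>e. e > 0 \<Longrightarrow> \<exists>\<delta>>0. \<forall>w\<in>W. l1_dist n w z < \<delta> \<longrightarrow>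
     (\<forall>j<m. cmod (f w j - f z j - (\<Sum>i<n. a j i * (w i - z i))) \<le> e * l1_dist n w z)"
    using holo_differentials[OF assms(1,2)] by blast
  define A where "A = real m * 1 + (\<Sum>j<m. \<Sum>i<n. cmod (a j i))"
  have A: "A \<ge> 0" by (simp add: A_def sum_nonneg)
  obtain \<delta> where \<delta>: "\<delta> > 0" "\<And>w. w\<in>W \<Longrightarrow> l1_dist n w z < \<delta> \<Longrightarrow>
     (\<forall>j<m. cmod (f w j - f z j - (\<Sum>i<n. a j i * (w i - z i))) \<le> 1 * l1_dist n w z)"
    using a[of 1] by (metis zero_less_one)
  have "l1_dist m (f w) (f z) < e" if "w \<in> W" "l1_dist n w z < min \<delta> (e / (A + 1))" for w
  proof -
    have "l1_dist m (f w) (f z) \<le> A * l1_dist n w z"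
      unfolding A_def using \<delta>(2)[of w] that by (intro l1_dist_image_le[where e = 1]) auto
    also have "\<dots> \<le> (A + 1) * l1_dist n w z" using l1_dist_nonneg by (simp add: mult_right_mono)
    also have "\<dots> < e" using that A by (simp add: pos_less_divide_eq mult.commute)
    finally show ?thesis .
  qed
  moreover have "min \<delta> (e / (A + 1)) > 0" using \<delta>(1) A assms(3) by simp
  ultimately show ?thesis by blast
qed

lemma holo_continuous_map:
  assumes "holo n m f W"
  shows "continuous_map (subtopology (Ctop n) W) (Ctop m) f"
  unfolding continuous_map
proof (intro conjI allI impI)
  have W: "openin (Ctop n) W" using holo_open[OF assms] .
  show "f ` topspace (subtopology (Ctop n) W) \<subseteq> topspace (Ctop m)"
    using holo_image[OF assms] openin_subset[OF W] by auto
  fix U assume U: "openin (Ctop m) U"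
  have "openin (Ctop n) {x \<in> W. f x \<in> U}"
    unfolding openin_Ctop_iff
  proof (intro conjI ballI)
    fix z assume z: "z \<in> {x \<in> W. f x \<in> U}"
    then obtain e where e: "e > 0" "\<And>y. y \<in> Cspace m \<Longrightarrow> l1_dist m y (f z) < e \<Longrightarrow> y \<in> U"
      using U by (auto simp: openin_Ctop_iff)
    obtain \<delta> where "\<delta> > 0" "\<forall>w\<in>W. l1_dist n w z < \<delta> \<longrightarrow> l1_dist m (f w) (f z) < e"
      using holo_continuous[OF assms _ e(1)] z by blast
    moreover obtain d where "d > 0" "\<And>w. w \<in> Cspace n \<Longrightarrow> l1_dist n w z < d \<Longrightarrow> w \<in> W"
      using W z by (auto simp: openin_Ctop_iff)
    ultimately show "\<exists>\<delta>>0. \<forall>w\<in>Cspace n. l1_dist n w z < \<delta> \<longrightarrow> w \<in> {x \<in> W. f x \<in> U}"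
      using e(2) holo_image[OF assms] by (intro exI[of _ "min \<delta> d"]) (auto simp: image_subset_iff)
  qed (use openin_subset[OF W] in auto)
  moreover have "{x \<in> topspace (subtopology (Ctop n) W). f x \<in> U} = {x \<in> W. f x \<in> U}"
    using openin_subset[OF W] by auto
  ultimately show "openin (subtopology (Ctop n) W) {x \<in> topspace (subtopology (Ctop n) W). f x \<in> U}"
    using W by (simp add: openin_open_subtopology)
qed

text \<open>
  The chain rule: with \<open>b\<close> the differential of \<open>g\<close> and \<open>a\<close> that of \<open>f\<close>, the differential of the
  composition is the matrix product \<open>c\<close>.
\<close>

lemma holo_compose:
  assumes f: "holo n m f W" and g: "holo m l g V" and sub: "f ` W \<subseteq> V"
  shows "holo n l (g \<circ> f) W"
  unfolding holo_iff
proof (intro conjI ballI allI impI)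
  show "(g \<circ> f) ` W \<subseteq> Cspace l" using sub holo_image[OF g] by auto
next
  fix z r assume z: "z \<in> W" and r: "r < l"
  obtain a where a: "\<And>e. e > 0 \<Longrightarrow> \<exists>\<delta>>0. \<forall>w\<in>W. l1_dist n w z < \<delta> \<longrightarrow>
     (\<forall>j<m. cmod (f w j - f z j - (\<Sum>i<n. a j i * (w i - z i))) \<le> e * l1_dist n w z)"
    using holo_differentials[OF f z] by blast
  obtain b where b: "differential_at m V (\<lambda>y. g y r) (f z) b"
    using g z sub r unfolding holo_iff by blast
  define c where "c i = (\<Sum>j<m. b j * a j i)" for i
  define A where "A = real m * 1 + (\<Sum>j<m. \<Sum>i<n. cmod (a j i))"
  define B where "B = (\<Sum>j<m. cmod (b j))"
  have A: "A \<ge> 0" and B: "B \<ge> 0" by (simp_all add: A_def B_def sum_nonneg)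
  have "differential_at n W (\<lambda>w. (g \<circ> f) w r) z c"
    unfolding differential_at_def
  proof (intro allI impI)
    fix e :: real assume e: "e > 0"
    \<comment> \<open>\<open>e1\<close> bounds the error of \<open>f\<close>, which \<open>g\<close> magnifies by at most \<open>B\<close>; \<open>e2\<close> bounds the error of
      \<open>g\<close> relative to the displacement of \<open>f\<close>, itself at most \<open>A\<close> times that of the argument.
      Each contributes half of \<open>e\<close>.\<close>
    define e1 where "e1 = min 1 (e / 2 / (B + 1))"
    define e2 where "e2 = e / 2 / (A + 1)"
    have e1: "e1 > 0" "e1 \<le> 1" "e1 \<le> e / 2 / (B + 1)" and e2: "e2 > 0"
      using e A B by (simp_all add: e1_def e2_def)
    have e1B: "B * e1 \<le> e / 2"
    proof -
      have "B * e1 \<le> (B + 1) * e1" using e1 by simp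
      also have "\<dots> \<le> e / 2" using e1(3) B by (simp add: field_simps)
      finally show ?thesis .
    qed
    have e2A: "e2 * A \<le> e / 2"
    proof -
      have "e2 * A \<le> e2 * (A + 1)" using e2 by simp
      also have "\<dots> = e / 2"
      proof -
        have "A + 1 \<noteq> 0" using A by linarith
        then show ?thesis unfolding e2_def by (metis nonzero_eq_divide_eq)
      qed
      finally show ?thesis .
    qed
    obtain \<delta>1 where \<delta>1: "\<delta>1 > 0" "\<And>w. w\<in>W \<Longrightarrow> l1_dist n w z < \<delta>1 \<Longrightarrow>
       (\<forall>j<m. cmod (f w j - f z j - (\<Sum>i<n. a j i * (w i - z i))) \<le> e1 * l1_dist n w z)"
      using a[OF e1(1)] by metis
    obtain d where d: "d > 0" "\<And>y. y\<in>V \<Longrightarrow> l1_dist m y (f z) < d \<Longrightarrow>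
       cmod (g y r - g (f z) r - (\<Sum>j<m. b j * (y j - f z j))) \<le> e2 * l1_dist m y (f z)"
      using b e2 unfolding differential_at_def by metis
    obtain \<delta>2 where \<delta>2: "\<delta>2 > 0" "\<And>w. w \<in> W \<Longrightarrow> l1_dist n w z < \<delta>2 \<Longrightarrow> l1_dist m (f w) (f z) < d"
      using holo_continuous[OF f z d(1)] by metis
    have "cmod ((g \<circ> f) w r - (g \<circ> f) z r - (\<Sum>i<n. c i * (w i - z i))) \<le> e * l1_dist n w z"
      if w: "w \<in> W" "l1_dist n w z < min \<delta>1 \<delta>2" for w
    proof -
      let ?D = "l1_dist n w z"
      let ?s = "\<lambda>j. f w j - f z j - (\<Sum>i<n. a j i * (w i - z i))"
      have s: "cmod (?s j) \<le> e1 * ?D" if "j < m" for j using \<delta>1(2)[of w] w that by simp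
      have split: "(\<Sum>j<m. b j * (f w j - f z j)) = (\<Sum>j<m. b j * ?s j) + (\<Sum>i<n. c i * (w i - z i))"
      proof -
        have "(\<Sum>i<n. c i * (w i - z i)) = (\<Sum>j<m. b j * (\<Sum>i<n. a j i * (w i - z i)))"
          unfolding c_def sum_distrib_right sum_distrib_left mult.assoc by (rule sum.swap)
        then show ?thesis by (simp add: right_diff_distrib sum_subtractf)
      qed
      have "l1_dist m (f w) (f z) \<le> A * ?D"
      proof -
        have "l1_dist m (f w) (f z) \<le> (real m * 1 + (\<Sum>j<m. \<Sum>i<n. cmod (a j i))) * ?D"
        proof (rule l1_dist_image_le)
          fix j assume "j < m"
          have "e1 * ?D \<le> 1 * ?D" using e1 l1_dist_nonneg by (intro mult_right_mono)
          then show "cmod (?s j) \<le> 1 * ?D" using s[OF \<open>j < m\<close>] by linarith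
        qed
        then show ?thesis by (simp add: A_def)
      qed
      then have "e2 * l1_dist m (f w) (f z) \<le> e2 * A * ?D"
        using e2 by (simp add: mult.assoc mult_left_mono)
      also have "\<dots> \<le> e / 2 * ?D" using e2A l1_dist_nonneg by (intro mult_right_mono)
      finally have g1: "cmod (g (f w) r - g (f z) r - (\<Sum>j<m. b j * (f w j - f z j))) \<le> e / 2 * ?D"
        using d(2)[of "f w"] \<delta>2(2)[of w] w sub by fastforce
      have "cmod (\<Sum>j<m. b j * ?s j) \<le> (\<Sum>j<m. cmod (b j) * (e1 * ?D))"
        by (rule sum_norm_le) (auto simp: norm_mult intro!: mult_left_mono s)
      also have "\<dots> = B * e1 * ?D" by (simp add: B_def sum_distrib_right mult.assoc)
      also have "\<dots> \<le> e / 2 * ?D" using e1B l1_dist_nonneg by (intro mult_right_mono)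
      finally have g2: "cmod (\<Sum>j<m. b j * ?s j) \<le> e / 2 * ?D" .
      have "(g \<circ> f) w r - (g \<circ> f) z r - (\<Sum>i<n. c i * (w i - z i)) =
         (g (f w) r - g (f z) r - (\<Sum>j<m. b j * (f w j - f z j))) + (\<Sum>j<m. b j * ?s j)"
        unfolding split by simp
      then show ?thesis using g1 g2 norm_triangle_ineq by (smt (verit) field_sum_of_halves distrib_right)
    qed
    then show "\<exists>\<delta>>0. \<forall>w\<in>W. l1_dist n w z < \<delta> \<longrightarrow>
       cmod ((g \<circ> f) w r - (g \<circ> f) z r - (\<Sum>i<n. c i * (w i - z i))) \<le> e * l1_dist n w z"
      using \<delta>1(1) \<delta>2(1) by (intro exI[of _ "min \<delta>1 \<delta>2"]) auto
  qed
  then show "\<exists>a. differential_at n W (\<lambda>w. (g \<circ> f) w r) z a" by (rule exI[of _ c])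
qed (fact holo_open[OF f])

lemma openin_Ctop_slice:
  assumes "openin (Ctop n) W" "k \<le> n"
  shows "openin (Ctop k) (W \<inter> Cspace k)"
  unfolding openin_Ctop_iff
proof (intro conjI ballI)
  fix z assume z: "z \<in> W \<inter> Cspace k"
  then obtain \<delta> where "\<delta> > 0" "\<forall>w\<in>Cspace n. l1_dist n w z < \<delta> \<longrightarrow> w \<in> W"
    using assms(1) by (auto simp: openin_Ctop_iff)
  then show "\<exists>\<delta>>0. \<forall>w\<in>Cspace k. l1_dist k w z < \<delta> \<longrightarrow> w \<in> W \<inter> Cspace k"
    using z Cspace_mono[OF assms(2)] l1_dist_Cspace_mono[OF _ _ assms(2)]
    by (intro exI[of _ \<delta>]) auto
qed simp

text \<open>
  A smaller space is a coordinate subspace of the larger one: on it the coefficients of the missing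
  coordinates meet vanishing differences. This is what makes a transition map between slice charts
  holomorphic on the slice.
\<close>

lemma holo_restrict:
  assumes f: "holo n m f W" and "k \<le> n" "l \<le> m" and im: "f ` (W \<inter> Cspace k) \<subseteq> Cspace l"
  shows "holo k l f (W \<inter> Cspace k)"
  unfolding holo_iff
proof (intro conjI ballI allI impI)
  fix z j assume z: "z \<in> W \<inter> Cspace k" and "j < l"
  then obtain a where a: "differential_at n W (\<lambda>w. f w j) z a"
    using f \<open>l \<le> m\<close> holo_differentiable by (metis IntD1 order_less_le_trans)
  have *: "(\<Sum>i<n. a i * (w i - z i)) = (\<Sum>i<k. a i * (w i - z i))" if "w \<in> Cspace k" for w
    by (rule sum.mono_neutral_right) (use that z \<open>k \<le> n\<close> in \<open>auto simp: Cspace_def\<close>)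
  have "differential_at k (W \<inter> Cspace k) (\<lambda>w. f w j) z a"
    unfolding differential_at_def
  proof (intro allI impI)
    fix e :: real assume "e > 0"
    with a obtain \<delta> where "\<delta> > 0" "\<forall>w\<in>W. l1_dist n w z < \<delta> \<longrightarrow>
        cmod (f w j - f z j - (\<Sum>i<n. a i * (w i - z i))) \<le> e * l1_dist n w z"
      unfolding differential_at_def by blast
    then show "\<exists>\<delta>>0. \<forall>w\<in>W \<inter> Cspace k. l1_dist k w z < \<delta> \<longrightarrow>
        cmod (f w j - f z j - (\<Sum>i<k. a i * (w i - z i))) \<le> e * l1_dist k w z"
      using z by (intro exI[of _ \<delta>]) (auto simp: * l1_dist_Cspace_mono[OF _ _ \<open>k \<le> n\<close>])
  qed
  then show "\<exists>a. differential_at k (W \<inter> Cspace k) (\<lambda>w. f w j) z a" by (rule exI[of _ a])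
qed (use openin_Ctop_slice[OF holo_open[OF f] \<open>k \<le> n\<close>] im in auto)

text \<open>
  Affine functions need no name for their coefficients once they are closed under the operations from
  which the coordinate changes below are built.
\<close>

definition affine_form :: "nat \<Rightarrow> ((nat \<Rightarrow> complex) \<Rightarrow> complex) \<Rightarrow> bool" where
  "affine_form n g \<longleftrightarrow> (\<exists>a b. \<forall>w. g w = b + (\<Sum>i<n. a i * w i))"

lemma affine_form_const: "affine_form n (\<lambda>w. c)"
  unfolding affine_form_def by (rule exI[of _ "\<lambda>_. 0"]) auto

lemma affine_form_coordinate:
  assumes "i < n" shows "affine_form n (\<lambda>w. w i)"
  unfolding affine_form_def
  by (rule exI[of _ "\<lambda>j. if j = i then 1 else 0"], rule exI[of _ 0])
     (use assms in \<open>auto simp: if_distrib[of "\<lambda>x. x * _"] cong: if_cong\<close>)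

lemma affine_form_add:
  assumes "affine_form n g" "affine_form n h" shows "affine_form n (\<lambda>w. g w + h w)"
proof -
  obtain a b a' b' where "\<And>w. g w = b + (\<Sum>i<n. a i * w i)" "\<And>w. h w = b' + (\<Sum>i<n. a' i * w i)"
    using assms unfolding affine_form_def by metis
  then show ?thesis unfolding affine_form_def
    by (intro exI[of _ "\<lambda>i. a i + a' i"] exI[of _ "b + b'"]) (simp add: distrib_right sum.distrib)
qed

lemma affine_form_diff:
  assumes "affine_form n g" "affine_form n h" shows "affine_form n (\<lambda>w. g w - h w)"
proof -
  obtain a b a' b' where "\<And>w. g w = b + (\<Sum>i<n. a i * w i)" "\<And>w. h w = b' + (\<Sum>i<n. a' i * w i)"
    using assms unfolding affine_form_def by metis
  then show ?thesis unfolding affine_form_def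
    by (intro exI[of _ "\<lambda>i. a i - a' i"] exI[of _ "b - b'"]) (simp add: left_diff_distrib sum_subtractf)
qed

lemma affine_form_sum:
  "(\<And>j. j \<in> J \<Longrightarrow> affine_form n (g j)) \<Longrightarrow> affine_form n (\<lambda>w. \<Sum>j\<in>J. g j w)"
  by (induction J rule: infinite_finite_induct) (auto intro: affine_form_const affine_form_add)

lemma affine_form_if:
  "(P \<Longrightarrow> affine_form n g) \<Longrightarrow> (\<not> P \<Longrightarrow> affine_form n h) \<Longrightarrow> affine_form n (\<lambda>w. if P then g w else h w)"
  by (cases P) simp_all

lemmas affine_form_intros = affine_form_if
  affine_form_const affine_form_coordinate affine_form_add affine_form_diff affine_form_sum

lemma holo_affine_forms:
  assumes "openin (Ctop n) W" "f ` W \<subseteq> Cspace m" "\<And>j. j < m \<Longrightarrow> affine_form n (\<lambda>w. f w j)"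
  shows "holo n m f W"
proof -
  obtain a b where "\<And>w j. j < m \<Longrightarrow> f w j = b j + (\<Sum>i<n. a j i * w i)"
    using assms(3) unfolding affine_form_def by metis
  then show ?thesis by (intro holo_affine[OF assms(1,2)]) auto
qed


section \<open>Charts, atlases and the induced structure on a submanifold\<close>

lemma homeomorphic_map_restrict:
  assumes "homeomorphic_map (subtopology X U) (subtopology Y V) f" "U \<subseteq> topspace X" "W \<subseteq> U"
  shows "homeomorphic_map (subtopology X W) (subtopology Y (f ` W)) f"
proof -
  have im: "f ` U = topspace Y \<inter> V"
    using homeomorphic_imp_surjective_map[OF assms(1)] assms(2) by (simp add: inf_absorb2)
  have "homeomorphic_map (subtopology (subtopology X U) W) (subtopology (subtopology Y V) (f ` W)) f"
    by (rule homeomorphic_map_subtopologies[OF assms(1)])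
       (use im assms(2,3) in \<open>auto simp: image_subset_iff\<close>)
  moreover have "U \<inter> W = W" "V \<inter> f ` W = f ` W" using im assms(3) by auto
  ultimately show ?thesis by (simp add: subtopology_subtopology)
qed

lemma is_chart_iff:
  "is_chart X n (U, \<phi>) \<longleftrightarrow> openin X U \<and> openin (Ctop n) (\<phi> ` U) \<and>
     homeomorphic_map (subtopology X U) (subtopology (Ctop n) (\<phi> ` U)) \<phi>"
  by (simp add: is_chart_def)

lemma is_chart_inj:
  assumes "is_chart X n (U, \<phi>)" shows "inj_on \<phi> U"
  using assms openin_subset[of X U] by (simp add: is_chart_iff homeomorphic_map_def inf_absorb2)

lemma is_chart_image_open:
  assumes "is_chart X n (U, \<phi>)" "openin X W" "W \<subseteq> U"
  shows "openin (Ctop n) (\<phi> ` W)"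
proof -
  have U: "openin X U" and o: "openin (Ctop n) (\<phi> ` U)"
    and h: "homeomorphic_map (subtopology X U) (subtopology (Ctop n) (\<phi> ` U)) \<phi>"
    using assms(1) by (simp_all add: is_chart_iff)
  have "openin (subtopology X U) W" using assms(2,3) U by (simp add: openin_open_subtopology)
  then have "openin (subtopology (Ctop n) (\<phi> ` U)) (\<phi> ` W)"
    using homeomorphic_map_openness_eq[OF h] by blast
  then show ?thesis using o by (simp add: openin_open_subtopology)
qed

lemma is_chart_restrict:
  assumes "is_chart X n (U, \<phi>)" "openin X W" "W \<subseteq> U"
  shows "is_chart X n (W, \<phi>)"
  using assms is_chart_image_open[OF assms] homeomorphic_map_restrict[of X U "Ctop n" "\<phi> ` U" \<phi> W]
    openin_subset[of X U]
  by (auto simp: is_chart_iff)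

lemma compatible_iff:
  "compatible n (U, \<phi>) (V, \<psi>) \<longleftrightarrow>
     holo n n (\<psi> \<circ> inv_into U \<phi>) (\<phi> ` (U \<inter> V)) \<and> holo n n (\<phi> \<circ> inv_into V \<psi>) (\<psi> ` (U \<inter> V))"
  by (simp add: compatible_def)

lemma holo_ident: "openin (Ctop n) W \<Longrightarrow> holo n n (\<lambda>x. x) W"
  by (rule holo_affine[where b = "\<lambda>_. 0" and a = "\<lambda>j i. if i = j then 1 else 0"])
     (auto dest!: openin_subset simp: if_distrib[of "\<lambda>x. x * _"] cong: if_cong)

lemma compatible_refl:
  assumes "is_chart X n (U, \<phi>)" shows "compatible n (U, \<phi>) (U, \<phi>)"
proof -
  have "holo n n (\<phi> \<circ> inv_into U \<phi>) (\<phi> ` U)"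
    by (rule holo_cong[OF holo_ident]) (use assms in \<open>auto simp: is_chart_iff f_inv_into_f\<close>)
  then show ?thesis by (simp add: compatible_iff)
qed

text \<open>
  Near a point in a chart \<open>(W, \<beta>)\<close> of the atlas, the transition map factors through \<open>\<beta>\<close> into two maps
  that are holomorphic by compatibility with the atlas.
\<close>

lemma holo_transition_via_atlas:
  assumes c: "is_chart X n (U, \<phi>)" and c': "is_chart X n (V, \<psi>)"
    and B: "\<And>b. b \<in> B \<Longrightarrow> is_chart X n b" "(\<Union>(W, \<beta>)\<in>B. W) = topspace X"
    and comp: "\<And>b. b \<in> B \<Longrightarrow> compatible n (U, \<phi>) b" "\<And>b. b \<in> B \<Longrightarrow> compatible n (V, \<psi>) b"
  shows "holo n n (\<psi> \<circ> inv_into U \<phi>) (\<phi> ` (U \<inter> V))"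
proof (rule holo_local)
  have o: "openin X U" "openin X V" using c c' by (auto simp: is_chart_iff)
  then show "openin (Ctop n) (\<phi> ` (U \<inter> V))" by (intro is_chart_image_open[OF c]) auto
  fix z assume "z \<in> \<phi> ` (U \<inter> V)"
  then obtain x where x: "x \<in> U" "x \<in> V" "z = \<phi> x" by auto
  then obtain W \<beta> where W: "(W, \<beta>) \<in> B" "x \<in> W" using B(2) o(1) openin_subset by blast
  have oW: "openin X W" using B(1)[OF W(1)] by (simp add: is_chart_iff)
  let ?N = "\<phi> ` (U \<inter> V \<inter> W)"
  have h1: "holo n n (\<beta> \<circ> inv_into U \<phi>) ?N"
    by (rule holo_subset[of _ _ _ "\<phi> ` (U \<inter> W)"])
       (use comp(1)[OF W(1)] o oW in \<open>auto simp: compatible_iff intro!: is_chart_image_open[OF c]\<close>)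
  have h2: "holo n n (\<psi> \<circ> inv_into W \<beta>) (\<beta> ` (V \<inter> W))"
    using comp(2)[OF W(1)] by (simp add: compatible_iff)
  have inv: "inv_into U \<phi> (\<phi> y) = y" if "y \<in> U" for y
    using is_chart_inj[OF c] that by simp
  have inv': "inv_into W \<beta> (\<beta> y) = y" if "y \<in> W" for y
    using is_chart_inj[OF B(1)[OF W(1)]] that by simp
  have "holo n n ((\<psi> \<circ> inv_into W \<beta>) \<circ> (\<beta> \<circ> inv_into U \<phi>)) ?N"
    by (rule holo_compose[OF h1 h2]) (auto simp: inv)
  then have "holo n n (\<psi> \<circ> inv_into U \<phi>) ?N"
    by (rule holo_cong) (auto simp: inv inv')
  then show "\<exists>N. z \<in> N \<and> N \<subseteq> \<phi> ` (U \<inter> V) \<and> holo n n (\<psi> \<circ> inv_into U \<phi>) N"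
    using x W(2) by (intro exI[of _ ?N]) auto
qed

definition is_atlas :: "'a topology \<Rightarrow> nat \<Rightarrow> 'a chart set \<Rightarrow> bool" where
  "is_atlas X n B \<longleftrightarrow> (\<forall>b\<in>B. is_chart X n b) \<and> (\<Union>(U, \<phi>)\<in>B. U) = topspace X \<and>
     (\<forall>b\<in>B. \<forall>b'\<in>B. compatible n b b')"

lemma atlas_subset_maximal_atlas: "is_atlas X n B \<Longrightarrow> B \<subseteq> maximal_atlas X n B"
  by (auto simp: is_atlas_def maximal_atlas_def)

text \<open>
  Maximality comes for free: a chart compatible with all of the maximal atlas is in particular
  compatible with the atlas \<open>B\<close>.
\<close>

lemma complex_manifold_maximal_atlas:
  assumes "Hausdorff_space X" "second_countable X" "is_atlas X n B"
  shows "complex_manifold \<lparr>mtop = X, mdim = n, charts = maximal_atlas X n B\<rparr>"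
proof -
  have B: "\<And>b. b \<in> B \<Longrightarrow> is_chart X n b" "(\<Union>(W, \<beta>)\<in>B. W) = topspace X"
    using assms(3) by (auto simp: is_atlas_def)
  have "compatible n c c'" if "c \<in> maximal_atlas X n B" "c' \<in> maximal_atlas X n B" for c c'
  proof -
    obtain U \<phi> V \<psi> where cc: "c = (U, \<phi>)" "c' = (V, \<psi>)" by (cases c, cases c')
    have "holo n n (\<psi> \<circ> inv_into U \<phi>) (\<phi> ` (U \<inter> V))" "holo n n (\<phi> \<circ> inv_into V \<psi>) (\<psi> ` (V \<inter> U))"
      by (rule holo_transition_via_atlas[OF _ _ B]; use that cc in \<open>auto simp: maximal_atlas_def\<close>)+
    then show ?thesis by (simp add: cc compatible_iff Int_commute)
  qed
  moreover have "(\<Union>(U, \<phi>)\<in>maximal_atlas X n B. U) = topspace X"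
  proof
    have "U \<subseteq> topspace X" if "(U, \<phi>) \<in> maximal_atlas X n B" for U \<phi>
      using that openin_subset[of X U] by (simp add: maximal_atlas_def is_chart_iff)
    then show "(\<Union>(U, \<phi>)\<in>maximal_atlas X n B. U) \<subseteq> topspace X" by auto
    show "topspace X \<subseteq> (\<Union>(U, \<phi>)\<in>maximal_atlas X n B. U)"
      using B(2) atlas_subset_maximal_atlas[OF assms(3)] by blast
  qed
  moreover have "maximal_atlas X n (maximal_atlas X n B) \<subseteq> maximal_atlas X n B"
    using atlas_subset_maximal_atlas[OF assms(3)] by (auto simp: maximal_atlas_def)
  ultimately show ?thesis
    using assms(1,2) by (auto simp: complex_manifold_def maximal_atlas_def)
qed

lemma manifold_is_chart: "complex_manifold M \<Longrightarrow> c \<in> charts M \<Longrightarrow> is_chart (mtop M) (mdim M) c"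
  by (simp add: complex_manifold_def)

lemma manifold_compatible:
  "complex_manifold M \<Longrightarrow> c \<in> charts M \<Longrightarrow> c' \<in> charts M \<Longrightarrow> compatible (mdim M) c c'"
  by (simp add: complex_manifold_def)

lemma chart_if_compatible:
  "complex_manifold M \<Longrightarrow> is_chart (mtop M) (mdim M) c \<Longrightarrow>
     (\<And>c'. c' \<in> charts M \<Longrightarrow> compatible (mdim M) c c') \<Longrightarrow> c \<in> charts M"
  unfolding complex_manifold_def maximal_atlas_def by blast

lemma second_countable_euclidean:
  "second_countable (euclidean :: 'a::second_countable_topology topology)"
proof -
  obtain \<B> :: "'a set set" where "countable \<B>" "\<And>C. C \<in> \<B> \<Longrightarrow> open C"
      "\<And>S. open S \<Longrightarrow> \<exists>U\<subseteq>\<B>. S = \<Union>U"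
    using univ_second_countable by metis
  then show ?thesis unfolding second_countable_def
    by (intro exI[of _ \<B>]) (fastforce simp: open_openin[symmetric])
qed

lemma Hausdorff_Ctop: "Hausdorff_space (Ctop n)"
  unfolding Ctop_def by (intro Hausdorff_space_subtopology Hausdorff_space_euclidean)

lemma second_countable_Ctop: "second_countable (Ctop n)"
  unfolding Ctop_def by (intro second_countable_subtopology second_countable_euclidean)

lemma is_atlas_Cspace: "is_atlas (Ctop n) n {(Cspace n, \<lambda>x. x)}"
proof -
  have "is_chart (Ctop n) n (Cspace n, \<lambda>x. x)"
    using openin_topspace[of "Ctop n"] homeomorphic_map_id[of "Ctop n" "Ctop n"]
    by (simp add: is_chart_iff id_def subtopology_topspace[of "Ctop n", simplified])
  then show ?thesis using compatible_refl by (auto simp: is_atlas_def)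
qed

lemma complex_manifold_Cmfd: "complex_manifold (Cmfd n)"
  unfolding Cmfd_def
  by (intro complex_manifold_maximal_atlas Hausdorff_Ctop second_countable_Ctop is_atlas_Cspace)

lemma biholomorphism_in_charts_Cmfd:
  assumes g: "holo n n g W" and h: "holo n n h (g ` W)" and inv: "\<And>x. x \<in> W \<Longrightarrow> h (g x) = x"
  shows "(W, g) \<in> charts (Cmfd n)"
proof -
  have o: "openin (Ctop n) W" "openin (Ctop n) (g ` W)" using g h holo_open by auto
  have sub: "W \<subseteq> Cspace n" using openin_subset[OF o(1)] by simp
  have inj: "inj_on g W" using inv by (metis inj_onI)
  have "homeomorphic_maps (subtopology (Ctop n) W) (subtopology (Ctop n) (g ` W)) g h"
    unfolding homeomorphic_maps_def
    using holo_continuous_map[OF g] holo_continuous_map[OF h] inv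
    by (auto simp: continuous_map_in_subtopology)
  then have "is_chart (Ctop n) n (W, g)" using o homeomorphic_map_maps by (auto simp: is_chart_iff)
  moreover have "compatible n (W, g) (Cspace n, \<lambda>x. x)"
    unfolding compatible_iff
  proof
    have "W \<inter> Cspace n = W" using sub by blast
    then show "holo n n ((\<lambda>x. x) \<circ> inv_into W g) (g ` (W \<inter> Cspace n))"
      using inj inv by (auto intro!: holo_cong[OF h])
    have "inv_into (Cspace n) (\<lambda>x. x) x = x" if "x \<in> W" for x
      using inv_into_f_f[of "\<lambda>x. x" "Cspace n" x] sub that by auto
    then show "holo n n (g \<circ> inv_into (Cspace n) (\<lambda>x. x)) ((\<lambda>x. x) ` (W \<inter> Cspace n))"
      using \<open>W \<inter> Cspace n = W\<close> by (auto intro!: holo_cong[OF g])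
  qed
  ultimately show ?thesis by (simp add: Cmfd_def maximal_atlas_def)
qed

lemma global_biholomorphism_in_charts_Cmfd:
  assumes g: "holo n n g (Cspace n)" and h: "holo n n h (Cspace n)"
    and hg: "\<And>x. x \<in> Cspace n \<Longrightarrow> h (g x) = x" and gh: "\<And>y. y \<in> Cspace n \<Longrightarrow> g (h y) = y"
    and W: "openin (Ctop n) W"
  shows "(W, g) \<in> charts (Cmfd n)"
proof (rule biholomorphism_in_charts_Cmfd)
  have sub: "W \<subseteq> Cspace n" using openin_subset[OF W] by simp
  show "holo n n g W" by (rule holo_subset[OF g W sub])
  have "g ` W = {y \<in> Cspace n. h y \<in> W}"
    using sub hg gh holo_image[OF g] by (force simp: image_iff)
  moreover have "openin (Ctop n) {y \<in> Cspace n. h y \<in> W}"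
  proof -
    have "continuous_map (Ctop n) (Ctop n) h"
      using holo_continuous_map[OF h] by (metis subtopology_topspace topspace_Ctop)
    from openin_continuous_map_preimage[OF this W] show ?thesis by simp
  qed
  ultimately show "holo n n h (g ` W)" by (auto intro!: holo_subset[OF h])
qed (use openin_subset[OF W] hg in auto)

lemma slice_chart_image:
  "(\<And>x. x \<in> U \<Longrightarrow> x \<in> S \<longleftrightarrow> \<phi> x \<in> Cspace k) \<Longrightarrow> \<phi> ` (U \<inter> S) = \<phi> ` U \<inter> Cspace k"
  by blast

lemma slice_chart_restrict_is_chart:
  assumes "is_chart X n (U, \<phi>)" "\<phi> ` (U \<inter> S) = \<phi> ` U \<inter> Cspace k" "k \<le> n"
  shows "is_chart (subtopology X S) k (U \<inter> S, \<phi>)"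
  unfolding is_chart_iff
proof (intro conjI)
  have U: "openin X U" and o: "openin (Ctop n) (\<phi> ` U)"
    and h: "homeomorphic_map (subtopology X U) (subtopology (Ctop n) (\<phi> ` U)) \<phi>"
    using assms(1) by (simp_all add: is_chart_iff)
  show "openin (subtopology X S) (U \<inter> S)" using U by (auto simp: openin_subtopology)
  show "openin (Ctop k) (\<phi> ` (U \<inter> S))" unfolding assms(2) by (rule openin_Ctop_slice[OF o assms(3)])
  have res: "homeomorphic_map (subtopology X (U \<inter> S)) (subtopology (Ctop n) (\<phi> ` (U \<inter> S))) \<phi>"
    by (rule homeomorphic_map_restrict[OF h openin_subset[OF U]]) auto
  have "S \<inter> (U \<inter> S) = U \<inter> S" by blast
  then have dom: "subtopology (subtopology X S) (U \<inter> S) = subtopology X (U \<inter> S)"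
    by (simp only: subtopology_subtopology)
  have "Cspace k \<inter> (\<phi> ` U \<inter> Cspace k) = Cspace n \<inter> (\<phi> ` U \<inter> Cspace k)"
    using Cspace_mono[OF assms(3)] by blast
  then have cod: "subtopology (Ctop k) (\<phi> ` (U \<inter> S)) = subtopology (Ctop n) (\<phi> ` (U \<inter> S))"
    by (simp only: Ctop_def subtopology_subtopology assms(2))
  show "homeomorphic_map (subtopology (subtopology X S) (U \<inter> S))
      (subtopology (Ctop k) (\<phi> ` (U \<inter> S))) \<phi>"
    unfolding dom cod by (rule res)
qed

text \<open>
  The image of the overlap with \<open>S\<close> is exactly the part of the overlap's image in the coordinate
  subspace, so the transition map of \<open>S\<close> is a restriction of the ambient one.
\<close>

lemma slice_charts_transition:
  assumes c: "is_chart X n (U, \<phi>)" "\<phi> ` (U \<inter> S) = \<phi> ` U \<inter> Cspace k"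
    and c': "\<psi> ` (V \<inter> S) = \<psi> ` V \<inter> Cspace k" and "k \<le> n"
    and holo: "holo n n (\<psi> \<circ> inv_into U \<phi>) (\<phi> ` (U \<inter> V))"
  shows "holo k k (\<psi> \<circ> inv_into (U \<inter> S) \<phi>) (\<phi> ` (U \<inter> S \<inter> (V \<inter> S)))"
proof -
  have inj: "inj_on \<phi> U" using is_chart_inj[OF c(1)] .
  then have injS: "inj_on \<phi> (U \<inter> S)" by (rule inj_on_subset) auto
  have im: "\<phi> ` (U \<inter> V) \<inter> Cspace k = \<phi> ` (U \<inter> S \<inter> (V \<inter> S))"
  proof
    show "\<phi> ` (U \<inter> V) \<inter> Cspace k \<subseteq> \<phi> ` (U \<inter> S \<inter> (V \<inter> S))"
    proof
      fix z assume "z \<in> \<phi> ` (U \<inter> V) \<inter> Cspace k"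
      then obtain x where x: "x \<in> U" "x \<in> V" "z = \<phi> x" "z \<in> Cspace k" by auto
      then have "z \<in> \<phi> ` (U \<inter> S)" using c(2) by auto
      then have "x \<in> S" using inj x by (metis IntE imageE inj_onD)
      with x show "z \<in> \<phi> ` (U \<inter> S \<inter> (V \<inter> S))" by auto
    qed
    show "\<phi> ` (U \<inter> S \<inter> (V \<inter> S)) \<subseteq> \<phi> ` (U \<inter> V) \<inter> Cspace k" using c(2) by blast
  qed
  have "holo k k (\<psi> \<circ> inv_into U \<phi>) (\<phi> ` (U \<inter> V) \<inter> Cspace k)"
  proof (rule holo_restrict[OF holo \<open>k \<le> n\<close> \<open>k \<le> n\<close>])
    show "(\<psi> \<circ> inv_into U \<phi>) ` (\<phi> ` (U \<inter> V) \<inter> Cspace k) \<subseteq> Cspace k"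
      unfolding im using inj c' by (fastforce simp: image_subset_iff)
  qed
  then show ?thesis unfolding im
    by (rule holo_cong) (use inj injS in auto)
qed

lemma submanifold_atlas:
  assumes M: "complex_manifold M" and S: "complex_submanifold M S k"
  shows "is_atlas (subtopology (mtop M) S) k ((\<lambda>(U, \<phi>). (U \<inter> S, \<phi>)) ` slice_charts M S k)"
proof -
  have k: "k \<le> mdim M" and ST: "S \<subseteq> topspace (mtop M)" and cov: "S \<subseteq> (\<Union>(U, \<phi>)\<in>slice_charts M S k. U)"
    using S by (auto simp: complex_submanifold_def)
  have sc: "is_chart (mtop M) (mdim M) (U, \<phi>)" "\<phi> ` (U \<inter> S) = \<phi> ` U \<inter> Cspace k" "(U, \<phi>) \<in> charts M"
    if "(U, \<phi>) \<in> slice_charts M S k" for U \<phi>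
    using that manifold_is_chart[OF M] by (auto simp: slice_charts_def)
  have tr: "holo k k (\<psi> \<circ> inv_into (U \<inter> S) \<phi>) (\<phi> ` (U \<inter> S \<inter> (V \<inter> S)))"
    if "(U, \<phi>) \<in> slice_charts M S k" "(V, \<psi>) \<in> slice_charts M S k" for U \<phi> V \<psi>
    using sc(1,2)[OF that(1)] sc(2)[OF that(2)] k
  proof (rule slice_charts_transition)
    show "holo (mdim M) (mdim M) (\<psi> \<circ> inv_into U \<phi>) (\<phi> ` (U \<inter> V))"
      using manifold_compatible[OF M sc(3)[OF that(1)] sc(3)[OF that(2)]] by (simp add: compatible_iff)
  qed
  have "compatible k (U \<inter> S, \<phi>) (V \<inter> S, \<psi>)"
    if "(U, \<phi>) \<in> slice_charts M S k" "(V, \<psi>) \<in> slice_charts M S k" for U \<phi> V \<psi>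
    using tr[OF that] tr[OF that(2,1)] by (simp add: compatible_iff Int_commute)
  moreover have "is_chart (subtopology (mtop M) S) k (U \<inter> S, \<phi>)" if "(U, \<phi>) \<in> slice_charts M S k" for U \<phi>
    using slice_chart_restrict_is_chart[OF sc(1,2)[OF that] k] .
  moreover have "(\<Union>(U, \<phi>)\<in>(\<lambda>(U, \<phi>). (U \<inter> S, \<phi>)) ` slice_charts M S k. U) = topspace (subtopology (mtop M) S)"
  proof -
    have "(\<Union>(U, \<phi>)\<in>(\<lambda>(U, \<phi>). (U \<inter> S, \<phi>)) ` slice_charts M S k. U) =
        (\<Union>(U, \<phi>)\<in>slice_charts M S k. U) \<inter> S" by auto
    then show ?thesis using cov ST by (simp add: inf_absorb2)
  qed
  ultimately show ?thesis unfolding is_atlas_def by (simp add: split_paired_all)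
qed

lemma complex_manifold_induced:
  assumes "complex_manifold M" "complex_submanifold M S k"
  shows "complex_manifold (induced_manifold M S k)"
  unfolding induced_manifold_def
  using assms by (intro complex_manifold_maximal_atlas submanifold_atlas)
    (auto simp: complex_manifold_def intro: Hausdorff_space_subtopology second_countable_subtopology)

lemma slice_chart_in_charts_induced:
  assumes "complex_manifold M" "complex_submanifold M S k" "(U, \<phi>) \<in> slice_charts M S k"
  shows "(U \<inter> S, \<phi>) \<in> charts (induced_manifold M S k)"
  using atlas_subset_maximal_atlas[OF submanifold_atlas[OF assms(1,2)]] assms(3)
  by (force simp: induced_manifold_def)


section \<open>Transport of charts along biholomorphic maps\<close>

lemma mfd_holomorphic_onD:
  assumes "mfd_holomorphic_on M N f W" "(U, \<phi>) \<in> charts M" "(V, \<psi>) \<in> charts N"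
  shows "holo (mdim M) (mdim N) (\<psi> \<circ> f \<circ> inv_into U \<phi>) (\<phi> ` {x \<in> U \<inter> W. f x \<in> V})"
  using assms by (fastforce simp: mfd_holomorphic_on_def)

text \<open>
  The transition maps between a transported chart and a chart of \<open>N\<close> are the coordinate expressions
  of \<open>f\<close> and of its inverse. These are holomorphic, and the maximality of the atlas of \<open>N\<close> then
  admits the transported chart.
\<close>

lemma biholomorphic_chart_transport:
  assumes N: "complex_manifold N" and f: "biholomorphic_betw M N f V U" and dim: "mdim N = mdim M"
    and c: "(W, \<psi>) \<in> charts M" "is_chart (mtop M) (mdim M) (W, \<psi>)"
    and W': "openin (mtop M) W'" "W' \<subseteq> W" "W' \<subseteq> V"
  shows "(f ` W', \<psi> \<circ> inv_into V f) \<in> charts N"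
proof -
  let ?g = "inv_into V f" and ?n = "mdim M"
  let ?\<phi> = "\<psi> \<circ> ?g"
  have bij: "bij_betw f V U" and fh: "mfd_holomorphic_on M N f V" and gh: "mfd_holomorphic_on N M ?g U"
    using f by (auto simp: biholomorphic_betw_def)
  have gf: "?g (f x) = x" if "x \<in> V" for x using bij that by (simp add: bij_betw_inv_into_left)
  have fg: "f (?g y) = y" "?g y \<in> V" if "y \<in> U" for y
    using bij that by (auto simp: bij_betw_inv_into_right bij_betw_def intro: inv_into_into)
  have fU: "f x \<in> U" if "x \<in> V" for x using bij that by (auto simp: bij_betw_def)
  have oU: "openin (mtop N) U" and oV: "openin (mtop M) V"
    and fc: "continuous_map (subtopology (mtop M) V) (mtop N) f"
    and gc: "continuous_map (subtopology (mtop N) U) (mtop M) ?g"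
    using fh gh by (auto simp: mfd_holomorphic_on_def)
  have UT: "U \<subseteq> topspace (mtop N)" and VT: "V \<subseteq> topspace (mtop M)" using oU oV openin_subset by auto
  have preim: "openin (mtop M) {x \<in> W'. f x \<in> Z}" if "openin (mtop N) Z" for Z
  proof -
    have "openin (mtop M) {x \<in> V. f x \<in> Z}"
      using openin_continuous_map_preimage[OF fc that] oV VT by (simp add: openin_open_subtopology inf_absorb2)
    moreover have "{x \<in> W'. f x \<in> Z} = W' \<inter> {x \<in> V. f x \<in> Z}" using W'(3) by auto
    ultimately show ?thesis using W'(1) by auto
  qed
  have fim: "f ` Y = {y \<in> U. ?g y \<in> Y}" if "Y \<subseteq> V" for Y
    using that fU gf fg by force
  have img: "openin (mtop N) (f ` W')"
    using openin_continuous_map_preimage[OF gc W'(1)] oU UT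
    by (simp add: openin_open_subtopology inf_absorb2 fim[OF W'(3)])
  have im\<phi>: "?\<phi> ` f ` Y = \<psi> ` Y" if "Y \<subseteq> V" for Y using that gf by (force simp: image_iff)
  have chart: "is_chart (mtop N) ?n (f ` W', ?\<phi>)"
    unfolding is_chart_iff
  proof (intro conjI img)
    show "openin (Ctop ?n) (?\<phi> ` f ` W')" unfolding im\<phi>[OF W'(3)]
      by (rule is_chart_image_open[OF c(2) W'(1,2)])
    have "homeomorphic_maps (subtopology (mtop N) U) (subtopology (mtop M) V) ?g f"
      unfolding homeomorphic_maps_def using fc gc fg gf fU by (auto simp: continuous_map_in_subtopology)
    then have "homeomorphic_map (subtopology (mtop N) U) (subtopology (mtop M) V) ?g"
      using homeomorphic_map_maps by blast
    then have "homeomorphic_map (subtopology (mtop N) (f ` W')) (subtopology (mtop M) (?g ` f ` W')) ?g"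
      by (rule homeomorphic_map_restrict[OF _ UT]) (use fU W'(3) in auto)
    moreover have "?g ` f ` W' = W'" using W'(3) gf by (force simp: image_iff)
    moreover have "homeomorphic_map (subtopology (mtop M) W') (subtopology (Ctop ?n) (\<psi> ` W')) \<psi>"
      using is_chart_restrict[OF c(2) W'(1,2)] by (simp add: is_chart_iff)
    ultimately show "homeomorphic_map (subtopology (mtop N) (f ` W'))
        (subtopology (Ctop ?n) (?\<phi> ` f ` W')) ?\<phi>"
      unfolding im\<phi>[OF W'(3)] by (metis homeomorphic_map_compose)
  qed
  show ?thesis
  proof (rule chart_if_compatible[OF N])
    show "is_chart (mtop N) (mdim N) (f ` W', ?\<phi>)" using chart dim by simp
    fix c' assume c': "c' \<in> charts N"
    obtain Z \<theta> where Z: "c' = (Z, \<theta>)" by (cases c')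
    have Zc: "is_chart (mtop N) ?n (Z, \<theta>)" using manifold_is_chart[OF N c'] Z dim by simp
    then have oZ: "openin (mtop N) Z" by (simp add: is_chart_iff)
    have eq: "f ` W' \<inter> Z = f ` {x \<in> W'. f x \<in> Z}" by auto
    have "holo ?n ?n (\<theta> \<circ> inv_into (f ` W') ?\<phi>) (?\<phi> ` (f ` W' \<inter> Z))"
    proof (rule holo_cong)
      show "holo ?n ?n (\<theta> \<circ> f \<circ> inv_into W \<psi>) (?\<phi> ` (f ` W' \<inter> Z))"
      proof (rule holo_subset)
        show "holo ?n ?n (\<theta> \<circ> f \<circ> inv_into W \<psi>) (\<psi> ` {x \<in> W \<inter> V. f x \<in> Z})"
          using mfd_holomorphic_onD[OF fh c(1)] c' Z dim by simp
        have e: "?\<phi> ` (f ` W' \<inter> Z) = \<psi> ` {x \<in> W'. f x \<in> Z}"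
          unfolding eq by (rule im\<phi>) (use W'(3) in auto)
        show "openin (Ctop ?n) (?\<phi> ` (f ` W' \<inter> Z))" unfolding e
          by (rule is_chart_image_open[OF c(2) preim[OF oZ]]) (use W'(2) in auto)
        show "?\<phi> ` (f ` W' \<inter> Z) \<subseteq> \<psi> ` {x \<in> W \<inter> V. f x \<in> Z}" unfolding e using W' by auto
      qed
      fix w assume "w \<in> ?\<phi> ` (f ` W' \<inter> Z)"
      then obtain x where x: "x \<in> W'" "f x \<in> Z" "w = ?\<phi> (f x)" by auto
      have "inv_into (f ` W') ?\<phi> w = f x"
        using is_chart_inj[OF chart] x by (simp del: comp_apply)
      moreover have "inv_into W \<psi> w = x"
        using is_chart_inj[OF c(2)] x gf W' by (simp add: subset_iff)
      ultimately show "(\<theta> \<circ> inv_into (f ` W') ?\<phi>) w = (\<theta> \<circ> f \<circ> inv_into W \<psi>) w" by simp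
    qed
    moreover have "holo ?n ?n (?\<phi> \<circ> inv_into Z \<theta>) (\<theta> ` (f ` W' \<inter> Z))"
    proof (rule holo_subset)
      show "holo ?n ?n (?\<phi> \<circ> inv_into Z \<theta>) (\<theta> ` {y \<in> Z \<inter> U. ?g y \<in> W})"
        using mfd_holomorphic_onD[OF gh _ c(1)] c' Z dim by simp
      show "openin (Ctop ?n) (\<theta> ` (f ` W' \<inter> Z))"
        by (rule is_chart_image_open[OF Zc]) (use img oZ in auto)
      show "\<theta> ` (f ` W' \<inter> Z) \<subseteq> \<theta> ` {y \<in> Z \<inter> U. ?g y \<in> W}"
        using W' gf fU by (intro image_mono) (auto simp: subset_iff)
    qed
    ultimately show "compatible (mdim N) (f ` W', ?\<phi>) c'" by (simp add: Z dim compatible_iff)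
  qed
qed


section \<open>The rational function of a parameter vector\<close>

lemma sum_Fract_same_denom:
  fixes c :: "'b::idom"
  assumes "c \<noteq> 0"
  shows "(\<Sum>i\<in>I. Fraction_Field.Fract (f i) c) = Fraction_Field.Fract (\<Sum>i\<in>I. f i) c"
proof (induction I rule: infinite_finite_induct)
  case (insert i I)
  have "Fraction_Field.Fract (f i) c + Fraction_Field.Fract (\<Sum>i\<in>I. f i) c
      = Fraction_Field.Fract (f i + (\<Sum>i\<in>I. f i)) c"
    using assms by (simp add: add_fract eq_fract algebra_simps)
  then show ?case using insert by simp
qed (use assms in \<open>simp_all add: Zero_fract_def eq_fract\<close>)

lemma eventually_at_notin_finite:
  fixes a :: "'a::t1_space"
  assumes "finite F" shows "\<forall>\<^sub>F z in at a. z \<notin> F"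
proof -
  have "open (- (F - {a}))" using assms by (intro open_Compl finite_imp_closed) auto
  then show ?thesis by (auto simp: eventually_at_topological intro!: exI[of _ "- (F - {a})"])
qed

lemma residue_sum:
  assumes "finite I" "open s" "z \<in> s" "\<And>i. i \<in> I \<Longrightarrow> f i holomorphic_on s - {z}"
  shows "residue (\<lambda>w. \<Sum>i\<in>I. f i w) z = (\<Sum>i\<in>I. residue (f i) z)"
  using assms(1,4)
proof (induction I rule: finite_induct)
  case (insert i I)
  then show ?case using assms(2,3)
    by (simp add: residue_add[OF assms(2,3)] holomorphic_intros)
qed (simp add: residue_const)

text \<open>
  The principal part term by term: only the simple pole contributes to the residue.
\<close>

lemma residue_const_over_power:
  assumes "l \<ge> 1" shows "residue (\<lambda>z. c / (z - a) ^ l) a = (if l = 1 then c else 0)"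
proof -
  have "(deriv ^^ m) (\<lambda>_. c) a = (if m = 0 then c else 0)" for m
    by (simp add: higher_deriv_const)
  then show ?thesis
    using residue_holomorphic_over_power[of UNIV a "\<lambda>_. c" "l - 1"] assms by auto
qed

lemma denom_nonzero: "denom R \<noteq> 0"
  by (simp add: denom_def snd_quot_of_fract_nonzero)

lemma fixpoint_poly_denom_no_common_root:
  assumes "poly (denom R) z = 0" shows "poly (fixpoint_poly R) z \<noteq> 0"
proof
  assume "poly (fixpoint_poly R) z = 0"
  then have "poly (numer R) z = 0" using assms by (simp add: fixpoint_poly_def)
  then have "[:- z, 1:] dvd numer R" "[:- z, 1:] dvd denom R" using assms by (simp_all add: poly_eq_0_iff_dvd)
  then have "is_unit [:- z, 1:]"
    using coprime_quot_of_fract[of R] unfolding numer_def denom_def by (rule coprime_common_divisor[rotated])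
  then show False by (simp add: is_unit_iff_degree)
qed

context
  fixes p :: nat and n :: "nat \<Rightarrow> nat" and x :: "nat \<Rightarrow> complex"
  assumes n_pos: "\<And>k. k < p \<Longrightarrow> n k > 0" and p_pos: "p > 0"
    and inj: "inj_on x {..<p}"
    and lead: "\<And>k. k < p \<Longrightarrow> coeff_alpha p n x k (n k) \<noteq> 0"
begin

lemma P_hat_nonzero: "P_hat p n x \<noteq> 0"
  by (simp add: P_hat_def)

lemma poly_P_hat_eq_0_iff: "poly (P_hat p n x) z = 0 \<longleftrightarrow> z \<in> x ` {..<p}"
  using n_pos by (auto simp: P_hat_def poly_prod)

definition cofactor :: "nat \<Rightarrow> complex poly" where
  "cofactor k = (\<Prod>j\<in>{..<p} - {k}. [:- x j, 1:] ^ n j)"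

text \<open>
  The partial fraction decomposition over the common denominator \<open>P_hat\<close>.
\<close>

definition Q_explicit :: "complex poly" where
  "Q_explicit = (\<Sum>k<p. \<Sum>l=1..n k. smult (coeff_alpha p n x k l) ([:- x k, 1:] ^ (n k - l)) * cofactor k)"

lemma P_hat_split: "k < p \<Longrightarrow> P_hat p n x = [:- x k, 1:] ^ n k * cofactor k"
  by (simp add: P_hat_def cofactor_def prod.remove[of _ k])

lemma Q_poly_eq: "Q_poly p n x = Q_explicit"
proof -
  have term_eq: "Fraction_Field.Fract [:coeff_alpha p n x k l:] ([:- x k, 1:] ^ l) =
      Fraction_Field.Fract (smult (coeff_alpha p n x k l) ([:- x k, 1:] ^ (n k - l)) * cofactor k) (P_hat p n x)"
    if "k < p" "l \<le> n k" for k l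
  proof -
    have "[:- x k, 1:] ^ n k = [:- x k, 1:] ^ l * [:- x k, 1:] ^ (n k - l)"
      using that(2) by (simp flip: power_add)
    then have "[:coeff_alpha p n x k l:] * P_hat p n x =
        smult (coeff_alpha p n x k l) ([:- x k, 1:] ^ (n k - l)) * cofactor k * [:- x k, 1:] ^ l"
      unfolding P_hat_split[OF that(1)] by (simp add: mult_ac)
    then show ?thesis using P_hat_nonzero by (simp add: eq_fract)
  qed
  have "(\<Sum>k<p. \<Sum>l=1..n k. Fraction_Field.Fract [:coeff_alpha p n x k l:] ([:- x k, 1:] ^ l)) =
      Fraction_Field.Fract Q_explicit (P_hat p n x)"
    unfolding Q_explicit_def sum_Fract_same_denom[OF P_hat_nonzero, symmetric]
    by (intro sum.cong refl term_eq) auto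
  moreover have "Q = Q_explicit"
    if "Fraction_Field.Fract Q (P_hat p n x) = Fraction_Field.Fract Q_explicit (P_hat p n x)" for Q
    using that P_hat_nonzero by (simp add: eq_fract)
  ultimately show ?thesis unfolding Q_poly_def by (intro the_equality) auto
qed

text \<open>
  At \<open>\<zeta>\<^sub>k\<close> every summand vanishes except the one of the highest pole there, whose coefficient is
  nonzero. Hence \<open>Q_poly\<close> and \<open>P_hat\<close> have no common zero.
\<close>

lemma poly_Q_at_fixpoint:
  assumes "k < p" shows "poly (Q_poly p n x) (x k) \<noteq> 0"
proof -
  have 0: "poly (cofactor j) (x k) = 0" if "j < p" "j \<noteq> k" for j
    using that assms n_pos[OF assms] by (auto simp: cofactor_def poly_prod)
  have "poly (Q_poly p n x) (x k) =
      (\<Sum>j<p. \<Sum>l=1..n j. coeff_alpha p n x j l * (x k - x j) ^ (n j - l) * poly (cofactor j) (x k))"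
    by (simp add: Q_poly_eq Q_explicit_def poly_sum mult.assoc)
  also have "\<dots> = (\<Sum>j\<in>{k}. \<Sum>l=1..n j. coeff_alpha p n x j l * (x k - x j) ^ (n j - l) * poly (cofactor j) (x k))"
    by (rule sum.mono_neutral_right) (use assms 0 in auto)
  also have "\<dots> = (\<Sum>l=1..n k. coeff_alpha p n x k l * 0 ^ (n k - l) * poly (cofactor k) (x k))" by simp
  also have "\<dots> = (\<Sum>l\<in>{n k}. coeff_alpha p n x k l * 0 ^ (n k - l) * poly (cofactor k) (x k))"
    by (rule sum.mono_neutral_right) (use n_pos[OF assms] in auto)
  finally have "poly (Q_poly p n x) (x k) = coeff_alpha p n x k (n k) * poly (cofactor k) (x k)" by simp
  moreover have "poly (cofactor k) (x k) \<noteq> 0"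
    using inj assms by (auto simp: cofactor_def poly_prod inj_on_def)
  ultimately show ?thesis using lead[OF assms] by simp
qed

lemma Q_poly_nonzero: "Q_poly p n x \<noteq> 0"
  using poly_Q_at_fixpoint[OF p_pos] by auto

lemma poly_Q_over_P_hat:
  assumes "z \<notin> x ` {..<p}"
  shows "poly (Q_poly p n x) z / poly (P_hat p n x) z = (\<Sum>k<p. \<Sum>l=1..n k. coeff_alpha p n x k l / (z - x k) ^ l)"
proof -
  have "coeff_alpha p n x k l * (z - x k) ^ (n k - l) * poly (cofactor k) z / poly (P_hat p n x) z = coeff_alpha p n x k l / (z - x k) ^ l"
    if "k < p" "l \<le> n k" for k l
  proof -
    have "z - x k \<noteq> 0" using assms that by auto
    moreover have "poly (P_hat p n x) z \<noteq> 0" using assms poly_P_hat_eq_0_iff by blast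
    moreover have "(z - x k) ^ n k = (z - x k) ^ l * (z - x k) ^ (n k - l)"
      using that(2) by (simp flip: power_add)
    ultimately show ?thesis using P_hat_split[OF that(1)] by (auto simp: field_simps)
  qed
  then show ?thesis
    by (simp add: Q_poly_eq Q_explicit_def poly_sum sum_divide_distrib mult.assoc)
qed

text \<open>
  Both sides of \<open>z - R(z) = P_hat/Q_poly\<close> are fractions. Comparing them by cross-multiplication avoids
  the question which constant normalises numerator and denominator: neither orders of zeros nor
  quotients of values depend on it.
\<close>

lemma fixpoint_poly_cross:
  "fixpoint_poly (param_proj p n x) * Q_poly p n x = P_hat p n x * denom (param_proj p n x)"
proof -
  let ?R = "param_proj p n x"
  have "Fraction_Field.Fract (fixpoint_poly ?R) (denom ?R) =
      Fraction_Field.Fract [:0, 1:] 1 - Fraction_Field.Fract (numer ?R) (denom ?R)"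
    using denom_nonzero[of ?R] by (simp add: diff_fract fixpoint_poly_def)
  also have "Fraction_Field.Fract (numer ?R) (denom ?R) = ?R"
    by (simp add: numer_def denom_def Fract_quot_of_fract)
  also have "Fraction_Field.Fract [:0, 1:] 1 - ?R = Fraction_Field.Fract (P_hat p n x) (Q_poly p n x)"
    by (simp add: param_proj_def)
  finally show ?thesis using denom_nonzero Q_poly_nonzero by (simp add: eq_fract)
qed

text \<open>
  Compare orders in the identity \<open>fixpoint_poly_cross\<close>. On each side the two polynomials of the
  respective fraction have no common zero, so at any point at most one of them contributes.
\<close>

lemma order_fixpoint_poly: "order a (fixpoint_poly (param_proj p n x)) = order a (P_hat p n x)"
proof -
  let ?R = "param_proj p n x"
  have nz: "P_hat p n x * denom ?R \<noteq> 0" using P_hat_nonzero denom_nonzero by simp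
  have sum: "order a (fixpoint_poly ?R) + order a (Q_poly p n x) = order a (P_hat p n x) + order a (denom ?R)"
    using nz fixpoint_poly_cross by (metis order_mult)
  have coprime: "order a (fixpoint_poly ?R) = 0 \<or> order a (denom ?R) = 0"
    using fixpoint_poly_denom_no_common_root[of ?R a] by (metis order_0I)
  show ?thesis
  proof (cases "a \<in> x ` {..<p}")
    case True
    then have "order a (Q_poly p n x) = 0" using poly_Q_at_fixpoint by (auto intro: order_0I)
    moreover have "order a (P_hat p n x) \<noteq> 0"
      using True poly_P_hat_eq_0_iff P_hat_nonzero order_root by blast
    ultimately show ?thesis using sum coprime by linarith
  next
    case False
    then have "order a (P_hat p n x) = 0" using poly_P_hat_eq_0_iff by (auto intro: order_0I)
    then show ?thesis using sum coprime by linarith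
  qed
qed

lemma fixpoints_param_proj: "fixpoints (param_proj p n x) = x ` {..<p}"
proof -
  have "fixpoint_poly (param_proj p n x) \<noteq> 0"
    using fixpoint_poly_cross P_hat_nonzero denom_nonzero by (metis mult_eq_0_iff)
  then have "poly (fixpoint_poly (param_proj p n x)) z = 0 \<longleftrightarrow> poly (P_hat p n x) z = 0" for z
    using order_fixpoint_poly P_hat_nonzero by (simp add: order_root)
  then show ?thesis by (simp add: fixpoints_def poly_P_hat_eq_0_iff)
qed

lemma fixpoint_mult_param_proj: "fixpoint_mult (param_proj p n x) a = order a (P_hat p n x)"
  by (simp add: fixpoint_mult_def order_fixpoint_poly)

text \<open>
  Near a fixed point, \<open>1/(z - R(z))\<close> equals \<open>Q_poly/P_hat\<close>, that is, the sum of the partial fractions;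
  the index is therefore the coefficient of the simple pole.
\<close>

lemma fixpoint_index_param_proj:
  assumes "k < p" shows "fixpoint_index (param_proj p n x) (x k) = coeff_alpha p n x k 1"
proof -
  let ?R = "param_proj p n x" and ?a = "x k"
  let ?s = "- (x ` ({..<p} - {k}))"
  have s: "open ?s" by (intro open_Compl finite_imp_closed) auto
  have a: "?a \<in> ?s" using inj assms by (auto simp: inj_on_def)
  have "finite {z. poly (P_hat p n x * denom ?R) z = 0}"
    using P_hat_nonzero denom_nonzero by (intro poly_roots_finite) simp
  then have "\<forall>\<^sub>F z in at ?a. z \<notin> {z. poly (P_hat p n x * denom ?R) z = 0}"
    by (rule eventually_at_notin_finite)
  then have ev: "\<forall>\<^sub>F z in at ?a. 1 / (z - ratfun_eval ?R z) = (\<Sum>j<p. \<Sum>l=1..n j. coeff_alpha p n x j l / (z - x j) ^ l)"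
  proof (rule eventually_mono)
    fix z assume "z \<notin> {z. poly (P_hat p n x * denom ?R) z = 0}"
    then have P: "poly (P_hat p n x) z \<noteq> 0" and D: "poly (denom ?R) z \<noteq> 0" by auto
    let ?F = "poly (fixpoint_poly ?R) z" and ?Q = "poly (Q_poly p n x) z"
    have cross: "?F * ?Q = poly (P_hat p n x) z * poly (denom ?R) z"
      by (simp flip: poly_mult add: fixpoint_poly_cross)
    then have F: "?F \<noteq> 0" using P D by auto
    have "z - ratfun_eval ?R z = ?F / poly (denom ?R) z"
      using D by (simp add: ratfun_eval_def fixpoint_poly_def field_simps)
    then have "1 / (z - ratfun_eval ?R z) = ?Q / poly (P_hat p n x) z"
      using cross F P by (simp add: frac_eq_eq mult.commute)
    also have "\<dots> = (\<Sum>j<p. \<Sum>l=1..n j. coeff_alpha p n x j l / (z - x j) ^ l)"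
      using P poly_P_hat_eq_0_iff by (intro poly_Q_over_P_hat) blast
    finally show "1 / (z - ratfun_eval ?R z) = (\<Sum>j<p. \<Sum>l=1..n j. coeff_alpha p n x j l / (z - x j) ^ l)" .
  qed
  have hol: "(\<lambda>z. coeff_alpha p n x j l / (z - x j) ^ l) holomorphic_on ?s - {?a}" if "j < p" for j l
    using that by (intro holomorphic_intros) auto
  have res: "residue (\<lambda>z. coeff_alpha p n x j l / (z - x j) ^ l) ?a = (if j = k \<and> l = 1 then coeff_alpha p n x k 1 else 0)"
    if "j < p" "l \<ge> 1" for j l
  proof (cases "j = k")
    case True
    then show ?thesis using residue_const_over_power[OF that(2)] by auto
  next
    case False
    then have "(\<lambda>z. coeff_alpha p n x j l / (z - x j) ^ l) holomorphic_on ?s"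
      using that by (intro holomorphic_intros) auto
    then show ?thesis using residue_holo[OF s a] False by simp
  qed
  have "fixpoint_index ?R ?a = residue (\<lambda>z. \<Sum>j<p. \<Sum>l=1..n j. coeff_alpha p n x j l / (z - x j) ^ l) ?a"
    unfolding fixpoint_index_def by (rule residue_cong[OF ev refl])
  also have "\<dots> = (\<Sum>j<p. residue (\<lambda>z. \<Sum>l=1..n j. coeff_alpha p n x j l / (z - x j) ^ l) ?a)"
    by (rule residue_sum[OF _ s a]) (auto intro!: holomorphic_on_sum hol)
  also have "\<dots> = (\<Sum>j<p. \<Sum>l=1..n j. residue (\<lambda>z. coeff_alpha p n x j l / (z - x j) ^ l) ?a)"
    by (intro sum.cong refl residue_sum[OF _ s a]) (auto intro!: hol)
  also have "\<dots> = (\<Sum>j<p. \<Sum>l=1..n j. if j = k \<and> l = 1 then coeff_alpha p n x k 1 else 0)"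
    by (intro sum.cong refl res) auto
  also have "\<dots> = (\<Sum>j<p. if j = k then coeff_alpha p n x k 1 else 0)"
    using n_pos by (intro sum.cong refl) (auto simp: Suc_le_eq)
  also have "\<dots> = coeff_alpha p n x k 1" using assms by simp
  finally show ?thesis .
qed

end


section \<open>An affine chart adapted to the parameter space and its slices\<close>

text \<open>
  The affine chart: coordinates are renumbered by \<open>\<tau>\<close> and centred at \<open>c\<close>, except that the last one
  becomes the equation \<open>\<Sum>j\<in>B. x j = 1\<close>. If \<open>\<tau> (N - 1) \<in> B\<close>, the coordinate lost in this way
  can be recovered from that sum.
\<close>

definition straighten :: "nat \<Rightarrow> (nat \<Rightarrow> nat) \<Rightarrow> nat set \<Rightarrow> (nat \<Rightarrow> complex) \<Rightarrow> (nat \<Rightarrow> complex) \<Rightarrow> nat \<Rightarrow> complex" where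
  "straighten N \<tau> B c x i =
     (if i < N - 1 then x (\<tau> i) - c (\<tau> i) else if i = N - 1 then (\<Sum>j\<in>B. x j) - 1 else 0)"

lemma straighten_in_Cspace: "0 < N \<Longrightarrow> straighten N \<tau> B c x \<in> Cspace N"
  by (auto simp: Cspace_def straighten_def)

lemma straighten_in_charts_Cmfd:
  assumes \<tau>: "bij_betw \<tau> {..<N} {..<N}" and B: "B \<subseteq> {..<N}" and last: "\<tau> (N - 1) \<in> B"
    and c: "c \<in> Cspace N" and W: "openin (Ctop N) W"
  shows "(W, straighten N \<tau> B c) \<in> charts (Cmfd N)"
proof -
  define q where "q = \<tau> (N - 1)"
  define \<sigma> where "\<sigma> = inv_into {..<N} \<tau>"
  define h where "h y j = (if j < N then
      if j = q then y (N - 1) + 1 - (\<Sum>j\<in>B - {q}. y (\<sigma> j) + c j) else y (\<sigma> j) + c j else 0)"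
    for y :: "nat \<Rightarrow> complex" and j
  \<comment> \<open>\<open>h\<close> is the inverse: the coordinate \<open>q\<close> is obtained by solving the equation for it.\<close>
  let ?g = "straighten N \<tau> B c"
  have N: "N - 1 < N" "q < N" and q: "q \<in> B" using B last by (auto simp: q_def)
  have fin: "finite B" using B finite_subset by blast
  have \<sigma>\<tau>: "\<sigma> (\<tau> i) = i" and \<tau>N: "\<tau> i < N" if "i < N" for i
    using that \<tau> by (auto simp: \<sigma>_def bij_betw_inv_into_left bij_betw_def)
  have \<tau>\<sigma>: "\<tau> (\<sigma> j) = j" and \<sigma>N: "\<sigma> j < N" if "j < N" for j
    using that \<tau> inv_into_into[of j \<tau> "{..<N}"] by (auto simp: \<sigma>_def bij_betw_inv_into_right bij_betw_def)
  have \<sigma>q: "\<sigma> j < N - 1" if "j < N" "j \<noteq> q" for j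
  proof -
    have "\<sigma> j \<noteq> N - 1" using \<tau>\<sigma>[OF that(1)] that(2) by (auto simp: q_def)
    then show ?thesis using \<sigma>N[OF that(1)] by linarith
  qed
  have \<tau>q: "\<tau> i \<noteq> q" if "i < N - 1" for i
    using \<sigma>\<tau>[of i] \<sigma>\<tau>[of "N - 1"] that N by (auto simp: q_def)
  have sumB: "(\<Sum>j\<in>B. u j) = u q + (\<Sum>j\<in>B - {q}. u j)" for u :: "nat \<Rightarrow> complex"
    using fin q by (rule sum.remove)
  have open_all: "openin (Ctop N) (Cspace N)" using openin_topspace[of "Ctop N"] by simp
  show ?thesis
  proof (rule global_biholomorphism_in_charts_Cmfd[OF _ _ _ _ W])
    show "holo N N ?g (Cspace N)"
    proof (rule holo_affine_forms[OF open_all])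
      show "?g ` Cspace N \<subseteq> Cspace N" using N straighten_in_Cspace by auto
      fix i assume "i < N"
      show "affine_form N (\<lambda>x. ?g x i)"
        unfolding straighten_def using \<tau>N[OF \<open>i < N\<close>] B
        by (intro affine_form_intros) auto
    qed
    show "holo N N h (Cspace N)"
    proof (rule holo_affine_forms[OF open_all])
      show "h ` Cspace N \<subseteq> Cspace N" by (auto simp: Cspace_def h_def)
      fix j assume "j < N"
      then show "affine_form N (\<lambda>y. h y j)"
        unfolding h_def using \<sigma>N B N by (intro affine_form_intros) auto
    qed
    show "h (?g x) = x" if x: "x \<in> Cspace N" for x
    proof
      fix j
      have g: "?g x (\<sigma> j) + c j = x j" if "j < N" "j \<noteq> q" for j
        using \<sigma>q[OF that] \<tau>\<sigma>[OF that(1)] by (simp add: straighten_def)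
      have "(\<Sum>j\<in>B - {q}. ?g x (\<sigma> j) + c j) = (\<Sum>j\<in>B - {q}. x j)"
        by (intro sum.cong refl g) (use B in auto)
      moreover have "?g x (N - 1) = x q + (\<Sum>j\<in>B - {q}. x j) - 1" by (simp add: straighten_def sumB)
      moreover have "x j = 0" if "\<not> j < N" using x that by (simp add: Cspace_def)
      ultimately show "h (?g x) j = x j" using g by (simp add: h_def)
    qed
    show "?g (h y) = y" if y: "y \<in> Cspace N" for y
    proof
      fix i
      have hy: "h y j = y (\<sigma> j) + c j" if "j < N" "j \<noteq> q" for j using that by (simp add: h_def)
      have "(\<Sum>j\<in>B - {q}. h y j) = (\<Sum>j\<in>B - {q}. y (\<sigma> j) + c j)"
        by (intro sum.cong refl hy) (use B in auto)
      then have "(\<Sum>j\<in>B. h y j) - 1 = y (N - 1)" using N by (simp add: sumB h_def)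
      moreover have "h y (\<tau> i) - c (\<tau> i) = y i" if "i < N - 1"
        using hy[OF \<tau>N \<tau>q] that \<sigma>\<tau>[of i] by simp
      moreover have "y i = 0" if "\<not> i < N - 1" "i \<noteq> N - 1" using y that by (simp add: Cspace_def)
      ultimately show "?g (h y) i = y i" by (simp add: straighten_def)
    qed
  qed
qed

lemma straighten_last_coordinate:
  assumes "0 < N"
  shows "straighten N \<tau> B c x \<in> Cspace (N - 1) \<longleftrightarrow> (\<Sum>j\<in>B. x j) = 1"
proof -
  have "straighten N \<tau> B c x \<in> Cspace (N - 1) \<longleftrightarrow> straighten N \<tau> B c x (N - 1) = 0"
    using assms by (auto simp: Cspace_def straighten_def)
  then show ?thesis by (simp add: straighten_def)
qed

text \<open>
  On the affine hyperplane, agreement with \<open>c\<close> on \<open>A\<close> except at \<open>\<tau> (N - 1)\<close> forces agreement there,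
  since both sums over \<open>B\<close> are 1. So the \<open>card A - 1\<close> remaining conditions and the hyperplane together
  form one coordinate slice.
\<close>

lemma straighten_slice:
  assumes \<tau>: "bij_betw \<tau> {..<N} {..<N}" "\<tau> ` {k..<N} = A" and A: "B \<subseteq> A" "A \<subseteq> {..<N}" "\<tau> (N - 1) \<in> B"
    and "k < N"
    and c: "(\<Sum>j\<in>B. c j) = 1" and x: "(\<Sum>j\<in>B. x j) = 1"
  shows "straighten N \<tau> B c x \<in> Cspace k \<longleftrightarrow> (\<forall>j\<in>A. x j = c j)"
proof
  define q where "q = \<tau> (N - 1)"
  assume L: "straighten N \<tau> B c x \<in> Cspace k"
  have other: "x j = c j" if "j \<in> A" "j \<noteq> q" for j
  proof -
    obtain i where i: "k \<le> i" "i < N" "j = \<tau> i" using \<tau>(2) \<open>j \<in> A\<close> by auto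
    then have "i < N - 1" using that(2) by (cases "i = N - 1") (auto simp: q_def)
    moreover have "straighten N \<tau> B c x i = 0" using L i(1) by (simp add: Cspace_def)
    ultimately show ?thesis by (simp add: straighten_def i(3))
  qed
  have fin: "finite B" using A finite_subset[of B "{..<N}"] by auto
  have "(\<Sum>j\<in>B - {q}. x j) = (\<Sum>j\<in>B - {q}. c j)" using A other by (intro sum.cong) auto
  moreover have "x q + (\<Sum>j\<in>B - {q}. x j) = 1" "c q + (\<Sum>j\<in>B - {q}. c j) = 1"
    using c x sum.remove[OF fin, of q x] sum.remove[OF fin, of q c] A(3) by (simp_all add: q_def)
  ultimately have "x q = c q" by (metis add_right_cancel)
  with other show "\<forall>j\<in>A. x j = c j" by auto
next
  assume R: "\<forall>j\<in>A. x j = c j"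
  have "straighten N \<tau> B c x i = 0" if "k \<le> i" for i
  proof (cases "i < N - 1")
    case True
    then have "\<tau> i \<in> A" using \<tau>(2) that by auto
    with True R show ?thesis by (simp add: straighten_def)
  qed (use x in \<open>simp add: straighten_def\<close>)
  then show "straighten N \<tau> B c x \<in> Cspace k" by (simp add: Cspace_def)
qed

lemma ex_bij_moving_to_end:
  fixes A :: "nat set"
  assumes "A \<subseteq> {..<N}" "q \<in> A"
  obtains \<tau> where "bij_betw \<tau> {..<N} {..<N}" "\<tau> ` {N - card A..<N} = A" "\<tau> (N - 1) = q"
proof -
  define k where "k = N - card A"
  have fin: "finite A" using assms(1) finite_subset by blast
  have card: "card A \<le> N" "card A \<ge> 1" using card_mono[OF _ assms(1)] assms(2) fin
    by (auto simp: Suc_le_eq card_gt_0_iff)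
  have "card {..<k} = card ({..<N} - A)"
    using assms(1) fin by (simp add: card_Diff_subset k_def)
  then obtain \<tau>1 where \<tau>1: "bij_betw \<tau>1 {..<k} ({..<N} - A)"
    using finite_same_card_bij[of "{..<k}" "{..<N} - A"] by auto
  have "card {k..<N - 1} = card (A - {q})" using assms(2) card fin by (simp add: k_def)
  then obtain \<tau>2 where \<tau>2: "bij_betw \<tau>2 {k..<N - 1} (A - {q})"
    using finite_same_card_bij[of "{k..<N - 1}" "A - {q}"] fin by auto
  define \<tau> where "\<tau> i = (if i < k then \<tau>1 i else if i < N - 1 then \<tau>2 i else q)" for i
  have kN: "k \<le> N - 1" "N > 0" using card by (auto simp: k_def)
  have b1: "bij_betw \<tau> {..<k} ({..<N} - A)"
    using \<tau>1 by (rule bij_betw_cong[THEN iffD1, rotated]) (auto simp: \<tau>_def)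
  have b2: "bij_betw \<tau> {k..<N - 1} (A - {q})"
    using \<tau>2 by (rule bij_betw_cong[THEN iffD1, rotated]) (auto simp: \<tau>_def)
  have b3: "bij_betw \<tau> {N - 1} {q}" using kN by (auto simp: \<tau>_def bij_betw_def)
  have b23: "bij_betw \<tau> {k..<N} A"
  proof -
    have "bij_betw \<tau> ({k..<N - 1} \<union> {N - 1}) (A - {q} \<union> {q})"
      by (rule bij_betw_combine[OF b2 b3]) auto
    moreover have "{k..<N - 1} \<union> {N - 1} = {k..<N}" "A - {q} \<union> {q} = A" using kN assms(2) by auto
    ultimately show ?thesis by simp
  qed
  have "bij_betw \<tau> ({..<k} \<union> {k..<N}) ({..<N} - A \<union> A)"
    by (rule bij_betw_combine[OF b1 b23]) auto
  moreover have "{..<k} \<union> {k..<N} = {..<N}" "{..<N} - A \<union> A = {..<N}" using kN assms(1) by auto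
  ultimately have "bij_betw \<tau> {..<N} {..<N}" by simp
  moreover have "\<tau> ` {N - card A..<N} = A" using b23 by (simp add: bij_betw_def k_def)
  moreover have "\<tau> (N - 1) = q" using kN by (simp add: \<tau>_def)
  ultimately show thesis using that by blast
qed


section \<open>The slices of prescribed fixed points and indices\<close>

text \<open>
  The position of \<open>\<alpha>\<^sub>k\<^sub>,\<^sub>1\<close> in a parameter vector.
\<close>

definition block_start :: "nat \<Rightarrow> (nat \<Rightarrow> nat) \<Rightarrow> nat \<Rightarrow> nat" where
  "block_start p n k = p + (\<Sum>j<k. n j)"

lemma coeff_alpha_1: "coeff_alpha p n x k 1 = x (block_start p n k)"
  by (simp add: coeff_alpha_def block_start_def)

lemma block_end_le_block_start:
  "k < l \<Longrightarrow> block_start p n k + n k \<le> block_start p n l"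
proof -
  assume "k < l"
  then have "(\<Sum>j<Suc k. n j) \<le> (\<Sum>j<l. n j)" by (intro sum_mono2) auto
  then show ?thesis by (simp add: block_start_def)
qed

lemma inj_on_block_start:
  assumes "\<forall>k<p. n k > 0" shows "inj_on (block_start p n) {..<p}"
proof (rule linorder_inj_onI)
  fix k l assume "k < l" "k \<in> {..<p}" "l \<in> {..<p}"
  then show "block_start p n k \<noteq> block_start p n l"
    using block_end_le_block_start[of k l p n] assms by fastforce
qed auto

lemma sum_block_starts:
  assumes "\<forall>k<p. n k > 0"
  shows "(\<Sum>j\<in>block_start p n ` {..<p}. x j) = (\<Sum>k<p. coeff_alpha p n x k 1)"
  by (simp only: sum.reindex[OF inj_on_block_start[OF assms]] o_def coeff_alpha_1)

text \<open>
  The open set that \<open>param_space\<close> cuts with an affine hyperplane.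
\<close>

definition nondegenerate_params :: "nat \<Rightarrow> nat \<Rightarrow> (nat \<Rightarrow> nat) \<Rightarrow> (nat \<Rightarrow> complex) set" where
  "nondegenerate_params d p n =
     {x \<in> Cspace (d + p + 1). inj_on x {..<p} \<and> (\<forall>k<p. coeff_alpha p n x k (n k) \<noteq> 0)}"

lemma openin_nondegenerate_params: "openin (Ctop (d + p + 1)) (nondegenerate_params d p n)"
proof -
  have "open (\<Inter>k<p. {x :: nat \<Rightarrow> complex. coeff_alpha p n x k (n k) \<noteq> 0})"
    unfolding coeff_alpha_def by (intro open_INT finite_lessThan ballI open_Collect_coordinates_neq)
  then have "open ({x. inj_on x {..<p}} \<inter> (\<Inter>k<p. {x. coeff_alpha p n x k (n k) \<noteq> 0}))"
    using open_Collect_inj_on by blast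
  from openin_Ctop_Int[OF this] show ?thesis
    by (rule back_subst[of "openin _"]) (auto simp: nondegenerate_params_def)
qed

text \<open>
  The parameters are determined by the function only up to a permutation of the fixed points.
  The condition \<open>near\<close>, valid in a neighbourhood of \<open>x\<^sub>0\<close>, excludes all permutations but the identity:
  if \<open>x\<close> and \<open>x\<^sub>0\<close> have the same fixed points, then \<open>x k = x\<^sub>0 k\<close> for each \<open>k\<close>, and comparing indices
  fixes \<open>\<alpha>\<^sub>k\<^sub>,\<^sub>1\<close>.
\<close>

lemma prescribed_family_near:
  assumes n: "\<forall>k<p. n k > 0" "p > 0"
    and x0: "x\<^sub>0 \<in> param_space d p n" "param_proj p n x\<^sub>0 \<in> prescribed_family d p n \<zeta> \<iota>"
    and x: "x \<in> param_space d p n" "param_proj p n x \<in> overlap_family d p n"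
    and near: "\<forall>i<p. \<forall>j<p. i \<noteq> j \<longrightarrow> x i \<noteq> x\<^sub>0 j"
  shows "param_proj p n x \<in> prescribed_family d p n \<zeta> \<iota> \<longleftrightarrow>
           (\<forall>k<p. x k = x\<^sub>0 k \<and> coeff_alpha p n x k 1 = coeff_alpha p n x\<^sub>0 k 1)"
proof -
  have params0: "inj_on x\<^sub>0 {..<p}" "\<And>k. k < p \<Longrightarrow> coeff_alpha p n x\<^sub>0 k (n k) \<noteq> 0"
    and params: "inj_on x {..<p}" "\<And>k. k < p \<Longrightarrow> coeff_alpha p n x k (n k) \<noteq> 0"
    using x0(1) x(1) by (simp_all add: param_space_def)
  have fix0: "fixpoints (param_proj p n x\<^sub>0) = x\<^sub>0 ` {..<p}"
    and idx0: "\<And>k. k < p \<Longrightarrow> fixpoint_index (param_proj p n x\<^sub>0) (x\<^sub>0 k) = coeff_alpha p n x\<^sub>0 k 1"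
    and mult0: "\<And>a. fixpoint_mult (param_proj p n x\<^sub>0) a = order a (P_hat p n x\<^sub>0)"
    by (rule fixpoints_param_proj fixpoint_index_param_proj fixpoint_mult_param_proj;
        use n params0 in simp)+
  have fixx: "fixpoints (param_proj p n x) = x ` {..<p}"
    and idx: "\<And>k. k < p \<Longrightarrow> fixpoint_index (param_proj p n x) (x k) = coeff_alpha p n x k 1"
    and mult: "\<And>a. fixpoint_mult (param_proj p n x) a = order a (P_hat p n x)"
    by (rule fixpoints_param_proj fixpoint_index_param_proj fixpoint_mult_param_proj;
        use n params in simp)+
  have S0: "x\<^sub>0 ` {..<p} = \<zeta> ` {..<p}"
      "\<And>k. k < p \<Longrightarrow> fixpoint_mult (param_proj p n x\<^sub>0) (\<zeta> k) = n k"
      "\<And>k. k < p \<Longrightarrow> fixpoint_index (param_proj p n x\<^sub>0) (\<zeta> k) = \<iota> k"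
    using x0(2) fix0 by (auto simp: prescribed_family_def)
  show ?thesis
  proof
    assume "param_proj p n x \<in> prescribed_family d p n \<zeta> \<iota>"
    then have S: "x ` {..<p} = \<zeta> ` {..<p}"
        "\<And>k. k < p \<Longrightarrow> fixpoint_index (param_proj p n x) (\<zeta> k) = \<iota> k"
      using fixx by (auto simp: prescribed_family_def)
    show "\<forall>k<p. x k = x\<^sub>0 k \<and> coeff_alpha p n x k 1 = coeff_alpha p n x\<^sub>0 k 1"
    proof (intro allI impI)
      fix k assume k: "k < p"
      then have "x k \<in> x\<^sub>0 ` {..<p}" using S(1) S0(1) by auto
      then have eq: "x k = x\<^sub>0 k" using near k by auto
      have "x k \<in> \<zeta> ` {..<p}" using S(1) k by auto
      then obtain j where "j < p" "\<zeta> j = x k" by auto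
      then show "x k = x\<^sub>0 k \<and> coeff_alpha p n x k 1 = coeff_alpha p n x\<^sub>0 k 1"
        using eq idx[OF k] idx0[OF k] S(2)[of j] S0(3)[of j] by simp
    qed
  next
    assume R: "\<forall>k<p. x k = x\<^sub>0 k \<and> coeff_alpha p n x k 1 = coeff_alpha p n x\<^sub>0 k 1"
    have im: "x ` {..<p} = x\<^sub>0 ` {..<p}" using R by auto
    have "P_hat p n x = P_hat p n x\<^sub>0" using R by (simp add: P_hat_def)
    then have "fixpoint_mult (param_proj p n x) (\<zeta> k) = n k" if "k < p" for k
      using mult mult0 S0(2)[OF that] by simp
    moreover have "fixpoint_index (param_proj p n x) (\<zeta> k) = \<iota> k" if "k < p" for k
    proof -
      have "\<zeta> k \<in> x\<^sub>0 ` {..<p}" using S0(1) that by simp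
      then obtain j where "j < p" "\<zeta> k = x\<^sub>0 j" by auto
      then show ?thesis using R idx[of j] idx0[of j] S0(3)[OF that] by simp
    qed
    ultimately show "param_proj p n x \<in> prescribed_family d p n \<zeta> \<iota>"
      using x(2) fixx im S0(1) by (simp add: prescribed_family_def)
  qed
qed

text \<open>
  A preimage \<open>x\<^sub>0\<close> of \<open>y\<close> serves as the centre of the affine chart \<open>\<psi>\<close>, whose last coordinates are the
  fixed points, all \<open>\<alpha>\<^sub>k\<^sub>,\<^sub>1\<close> but one, and the hyperplane equation; composing with the inverse of the
  covering on a sheet through \<open>x\<^sub>0\<close> gives the slice chart.
\<close>

lemma slice_chart_at:
  assumes n: "\<forall>k<p. n k > 0" "(\<Sum>k<p. n k) = d + 1"
    and M: "overlap_structure d p n M"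
    and y: "y \<in> prescribed_family d p n \<zeta> \<iota>"
  shows "\<exists>U \<phi>. (U, \<phi>) \<in> slice_charts M (prescribed_family d p n \<zeta> \<iota>) (d + 1 - p) \<and> y \<in> U"
proof -
  let ?N = "d + p + 1" and ?S = "prescribed_family d p n \<zeta> \<iota>" and ?T = "param_space d p n"
  let ?f = "param_proj p n" and ?A = "param_mfd d p n" and ?k = "d + 1 - p"
  let ?W = "nondegenerate_params d p n"
  have mM: "complex_manifold M" "mdim M = d + p" "topspace (mtop M) = overlap_family d p n"
    and cov: "finite_holomorphic_covering ?A M ?f"
    using M by (auto simp: overlap_structure_def)
  have p: "p > 0" using n(2) by (cases p) auto
  have pd: "p \<le> d + 1"
  proof -
    have "(\<Sum>k<p. 1) \<le> (\<Sum>k<p. n k)" by (rule sum_mono) (use n(1) in \<open>auto simp: Suc_le_eq\<close>)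
    then show ?thesis using n(2) by simp
  qed
  have topA: "mtop ?A = subtopology (Ctop ?N) ?T" "mdim ?A = d + p"
    by (simp_all add: param_mfd_def induced_manifold_def Cmfd_def)
  have TC: "?T \<subseteq> Cspace ?N" by (auto simp: param_space_def)
  then have tsA: "topspace (mtop ?A) = ?T" by (auto simp: topA)
  have fT: "?f ` ?T = overlap_family d p n"
    using cov mM(3) tsA by (simp add: finite_holomorphic_covering_def)
  have yO: "y \<in> topspace (mtop M)" using y mM(3) by (simp add: prescribed_family_def)
  then have "y \<in> ?f ` ?T" using fT mM(3) by simp
  then obtain x\<^sub>0 where x0: "x\<^sub>0 \<in> ?T" "?f x\<^sub>0 = y" by (elim imageE) simp
  from cov yO obtain U \<V> where U: "y \<in> U" "\<Union>\<V> = {x \<in> topspace (mtop ?A). ?f x \<in> U}"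
      "\<forall>V\<in>\<V>. openin (mtop ?A) V \<and> biholomorphic_betw ?A M ?f V U"
    unfolding finite_holomorphic_covering_def by meson
  have "x\<^sub>0 \<in> \<Union>\<V>" using U(1,2) x0 tsA by auto
  then obtain V where V: "x\<^sub>0 \<in> V" "openin (mtop ?A) V" "biholomorphic_betw ?A M ?f V U"
    using U(3) by blast
  have injV: "inj_on ?f V" using V(3) by (simp add: biholomorphic_betw_def bij_betw_def)

  define B where "B = block_start p n ` {..<p}"
  define A where "A = {..<p} \<union> B"
  have B_N: "block_start p n k < ?N" if "k < p" for k
    using block_end_le_block_start[OF that, of p n] n that by (auto simp: block_start_def)
  have AN: "A \<subseteq> {..<?N}" using B_N by (auto simp: A_def B_def)
  have "card B = p" unfolding B_def using card_image[OF inj_on_block_start[OF n(1)]] by simp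
  moreover have "{..<p} \<inter> B = {}" by (auto simp: B_def block_start_def)
  ultimately have "card A = p + p" unfolding A_def by (subst card_Un_disjoint) (auto simp: B_def)
  then have kA: "?N - card A = ?k" using pd by simp
  have qB: "block_start p n 0 \<in> B" using p by (auto simp: B_def)
  then have "block_start p n 0 \<in> A" by (simp add: A_def)
  from ex_bij_moving_to_end[OF AN this] obtain \<tau> where \<tau>: "bij_betw \<tau> {..<?N} {..<?N}" "\<tau> ` {?k..<?N} = A" "\<tau> (?N - 1) = block_start p n 0"
    unfolding kA .
  define \<psi> where "\<psi> = straighten ?N \<tau> B x\<^sub>0"
  have sumB: "(\<Sum>j\<in>B. x j) = (\<Sum>k<p. coeff_alpha p n x k 1)" for x
    unfolding B_def by (rule sum_block_starts[OF n(1)])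

  have "?W \<inter> ?T = ?T" by (auto simp: nondegenerate_params_def param_space_def)
  have \<psi>: "(?W, \<psi>) \<in> slice_charts (Cmfd ?N) ?T (d + p)"
  proof -
    have "(?W, \<psi>) \<in> charts (Cmfd ?N)" unfolding \<psi>_def
      using \<tau> AN qB x0(1) TC by (intro straighten_in_charts_Cmfd openin_nondegenerate_params) (auto simp: A_def)
    moreover have "x \<in> ?T \<longleftrightarrow> \<psi> x \<in> Cspace (d + p)" if "x \<in> ?W" for x
      using that straighten_last_coordinate[of ?N \<tau> B x\<^sub>0 x]
      by (auto simp: \<psi>_def sumB param_space_def nondegenerate_params_def)
    ultimately show ?thesis by (auto simp: slice_charts_def intro!: slice_chart_image)
  qed
  have subT: "complex_submanifold (Cmfd ?N) ?T (d + p)"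
    using \<psi> TC \<open>?W \<inter> ?T = ?T\<close> by (auto simp: complex_submanifold_def Cmfd_def[of ?N] simp del: One_nat_def)
  have \<psi>A: "(?T, \<psi>) \<in> charts ?A"
    using slice_chart_in_charts_induced[OF complex_manifold_Cmfd subT \<psi>] \<open>?W \<inter> ?T = ?T\<close>
    by (simp add: param_mfd_def)
  have "complex_manifold ?A"
    unfolding param_mfd_def by (rule complex_manifold_induced[OF complex_manifold_Cmfd subT])
  then have chart: "is_chart (mtop ?A) (mdim ?A) (?T, \<psi>)" using \<psi>A manifold_is_chart by blast

  \<comment> \<open>Shrinking the sheet keeps the labelling of the fixed points by \<open>x\<^sub>0\<close>.\<close>
  define W' where "W' = V \<inter> {x. \<forall>i<p. \<forall>j<p. i \<noteq> j \<longrightarrow> x i \<noteq> x\<^sub>0 j}"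
  have VT: "V \<subseteq> ?T" using openin_subset[OF V(2)] tsA by simp
  have oW': "openin (mtop ?A) W'"
  proof -
    let ?G = "{x :: nat \<Rightarrow> complex. \<forall>i<p. \<forall>j<p. i \<noteq> j \<longrightarrow> x i \<noteq> x\<^sub>0 j}"
    have "openin (mtop ?A) (Cspace ?N \<inter> ?G \<inter> ?T)"
      using openin_Ctop_Int[OF open_Collect_separated] unfolding topA by (auto simp: openin_subtopology)
    then have "openin (mtop ?A) (V \<inter> (Cspace ?N \<inter> ?G \<inter> ?T))" using V(2) by (rule openin_Int[rotated])
    moreover have "V \<inter> (Cspace ?N \<inter> ?G \<inter> ?T) = W'" using VT TC by (auto simp: W'_def)
    ultimately show ?thesis by simp
  qed
  have x0W': "x\<^sub>0 \<in> W'" using V(1) x0(1) by (auto simp: W'_def param_space_def inj_on_def)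
  have W'V: "W' \<subseteq> V" by (auto simp: W'_def)
  let ?\<phi> = "\<psi> \<circ> inv_into V ?f"
  have "(?f ` W', ?\<phi>) \<in> charts M"
    by (rule biholomorphic_chart_transport[OF mM(1) V(3) _ \<psi>A chart oW' _ W'V])
       (use W'V VT topA mM(2) in auto)
  moreover have "?\<phi> ` (?f ` W' \<inter> ?S) = ?\<phi> ` ?f ` W' \<inter> Cspace ?k"
  proof (rule slice_chart_image)
    fix z assume "z \<in> ?f ` W'"
    then obtain x where x: "x \<in> W'" "z = ?f x" by auto
    then have xT: "x \<in> ?T" using W'V VT by auto
    have "z \<in> ?S \<longleftrightarrow> (\<forall>k<p. x k = x\<^sub>0 k \<and> coeff_alpha p n x k 1 = coeff_alpha p n x\<^sub>0 k 1)"
      unfolding x(2)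
      by (rule prescribed_family_near[OF n(1) p x0(1) _ xT]) (use x x0 y fT xT in \<open>auto simp: W'_def\<close>)
    also have "\<dots> \<longleftrightarrow> (\<forall>j\<in>A. x j = x\<^sub>0 j)"
      by (auto simp: A_def B_def coeff_alpha_1[simplified])
    also have "\<dots> \<longleftrightarrow> \<psi> x \<in> Cspace ?k"
      unfolding \<psi>_def
      by (rule straighten_slice[OF \<tau>(1,2) _ AN, symmetric])
         (use qB p \<tau>(3) xT x0(1) in \<open>auto simp: A_def sumB param_space_def\<close>)
    also have "\<psi> x = ?\<phi> z" using x W'V injV by (auto simp: inv_into_f_f)
    finally show "z \<in> ?S \<longleftrightarrow> ?\<phi> z \<in> Cspace ?k" .
  qed
  ultimately have "(?f ` W', ?\<phi>) \<in> slice_charts M ?S ?k"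
    unfolding slice_charts_def by blast
  then show ?thesis using x0W' x0(2) by blast
qed

theorem corollary2:
  fixes d p :: nat and n :: "nat \<Rightarrow> nat" and \<zeta> \<iota> :: "nat \<Rightarrow> complex"
    and M :: "complex poly fract cmanifold"
  assumes "d > 1"
    and "\<forall>k<p. n k > 0"
    and "(\<Sum>k<p. n k) = d + 1"
    and "inj_on \<zeta> {..<p}"
    and "overlap_structure d p n M"
    and "prescribed_family d p n \<zeta> \<iota> \<noteq> {}"
  shows "complex_submanifold M (prescribed_family d p n \<zeta> \<iota>) (d + 1 - p) \<and>
         complex_manifold (induced_manifold M (prescribed_family d p n \<zeta> \<iota>) (d + 1 - p))"
proof -
  let ?S = "prescribed_family d p n \<zeta> \<iota>"
  have M: "complex_manifold M" "mdim M = d + p" "topspace (mtop M) = overlap_family d p n"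
    using assms(5) by (auto simp: overlap_structure_def)
  have "p > 0" using assms(3) by (cases p) auto
  then have "d + 1 - p \<le> mdim M" using M(2) by simp
  moreover have "?S \<subseteq> topspace (mtop M)" using M(3) by (auto simp: prescribed_family_def)
  moreover have "?S \<subseteq> (\<Union>(U, \<phi>)\<in>slice_charts M ?S (d + 1 - p). U)"
    using slice_chart_at[OF assms(2,3,5)] by fastforce
  ultimately have "complex_submanifold M ?S (d + 1 - p)" by (simp add: complex_submanifold_def)
  then show ?thesis using complex_manifold_induced[OF M(1)] by blast
qed

end
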